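(* Let $k\geq 0$ and $\mathcal{P}\subseteq\mathbb{Z}_{\geq0}$, working with formal power series over a commutative ring $R\supseteq\mathbb{Q}$. Then $$\Xi^{k,\mathcal{P}}(z) = z\, T_{\leq k-1}^{\mathcal{P}}(z)\, e_{\mathcal{P}-2}\big(T^{\mathcal{P}}(z)\big)F^{\mathcal{P}}(z)^3,$$ $$\Xi^{\mathrm{partial}, k,\mathcal{P}}(z) = T_{\leq k-1}^{\mathcal{P}}(z)\, F^{\mathcal{P}}(z)^2\, e^{T^{\mathcal{P}}(z)} \Big(z\, e_{\mathcal{P}-2}\big(T^{\mathcal{P}}(z)\big)F^{\mathcal{P}}(z)+1\Big).$$
   Context: $[n]=\{1,\dots,n\}$. $e_\mathcal{P}(z)=\sum_{n\in\mathcal{P}}z^n/n!$, $\mathcal{P}-i=\{n-i:n\in\mathcal{P},n\ge i\}$, $e^z=\sum z^n/n!$; substitution of series with zero constant term is the usual formal composition. Labeled rooted tree: tree on vertex set $[m]$ with distinguished root; children of $v$ are its neighbours farther from the root; height is the maximal distance from the root (a single vertex has height 0); it satisfies $\mathcal{P}$ if every vertex has a number of children in $\mathcal{P}$. $T^\mathcal{P}_{\le h}(z)=\sum_t z^{|t|}/|t|!$ over such trees of height $\le h$ satisfying $\mathcal{P}$ (so $T^\mathcal{P}_{\le -1}=0$), and $T^\mathcal{P}(z)$ the same over all heights. Let $\mathcal{F}_n$ be the functions $f:[n]\to[n]$ with $|f^{-1}(x)|\in\mathcal{P}$ for all $x$ ($\mathcal{F}_0$ contains the empty function) and $\mathcal{Q}_n$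 the partial functions on $[n]$ (maps from a subset of $[n]$ into $[n]$) with $|f^{-1}(x)|\in\mathcal{P}$ for all $x\in[n]$. $F^\mathcal{P}(z)=\sum_n|\mathcal{F}_n|z^n/n!$. For $k\ge0$: $F^{k,\mathcal{P}}(u,z)=\sum_n\frac{z^n}{n!}\sum_{f\in\mathcal{F}_n}u^{\,n-|f^k([n])|}$ and $P^{k,\mathcal{P}}(u,z)=\sum_n\frac{z^n}{n!}\sum_{f\in\mathcal{Q}_n}u^{\,n-|f^k([n])|}$, where $f^k([n])$ is the set of values $f^k(x)$ over $x$ at which $f^k$ is defined. $\Xi^{k,\mathcal{P}}(z)=\big(\partial_uF^{k,\mathcal{P}}(u,z)\big)|_{u=1}$ and $\Xi^{\mathrm{partial},k,\mathcal{P}}(z)=\big(\partial_uP^{k,\mathcal{P}}(u,z)\big)|_{u=1}$. *)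

theory Defs
  imports "HOL-Computational_Algebra.Formal_Power_Series"
          "HOL-Computational_Algebra.Polynomial"
          "HOL-Library.FuncSet"
begin

text \<open>A commutative ring R contains Q iff every positive integer is invertible in R.
  qinv n is the (unique) inverse of n in R.\<close>
definition rat_ring :: "'a::comm_ring_1 itself \<Rightarrow> bool" where
  "rat_ring _ \<longleftrightarrow> (\<forall>n::nat. n > 0 \<longrightarrow> (\<exists>y::'a. of_nat n * y = 1))"

definition qinv :: "nat \<Rightarrow> 'a::comm_ring_1" where
  "qinv n = (THE y. of_nat n * y = 1)"

definition egf :: "(nat \<Rightarrow> nat) \<Rightarrow> 'a::comm_ring_1 fps" where
  "egf c = Abs_fps (\<lambda>n. of_nat (c n) * qinv (fact n))"

definition eP :: "nat set \<Rightarrow> 'a::comm_ring_1 fps" where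
  "eP P = Abs_fps (\<lambda>n. if n \<in> P then qinv (fact n) else 0)"

definition shiftP :: "nat set \<Rightarrow> nat \<Rightarrow> nat set" where
  "shiftP P i = {n - i | n. n \<in> P \<and> n \<ge> i}"

text \<open>A labeled rooted tree on vertex set [m] = {1..m} with root r is encoded by its
  parent map par: par r = r, par v is the neighbour of v one step closer to the root,
  and every vertex reaches the root by iterating par.  Outside [m], par is the identity
  (canonical representative, so trees correspond bijectively to such maps).\<close>
definition rooted_tree :: "nat \<Rightarrow> (nat \<Rightarrow> nat) \<Rightarrow> nat \<Rightarrow> bool" where
  "rooted_tree m par r \<longleftrightarrow> r \<in> {1..m} \<and> par r = r \<and>
     (\<forall>v\<in>{1..m}. par v \<in> {1..m}) \<and> (\<forall>v. v \<notin> {1..m} \<longrightarrow> par v = v) \<and>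
     (\<forall>v\<in>{1..m}. \<exists>j. (par ^^ j) v = r)"

definition tree_children :: "nat \<Rightarrow> (nat \<Rightarrow> nat) \<Rightarrow> nat \<Rightarrow> nat \<Rightarrow> nat set" where
  "tree_children m par r v = {w \<in> {1..m}. w \<noteq> r \<and> par w = v}"

definition tree_depth :: "(nat \<Rightarrow> nat) \<Rightarrow> nat \<Rightarrow> nat \<Rightarrow> nat" where
  "tree_depth par r v = (LEAST j. (par ^^ j) v = r)"

definition tree_height :: "nat \<Rightarrow> (nat \<Rightarrow> nat) \<Rightarrow> nat \<Rightarrow> nat" where
  "tree_height m par r = Max ((tree_depth par r) ` {1..m})"

definition sat_P :: "nat set \<Rightarrow> nat \<Rightarrow> (nat \<Rightarrow> nat) \<Rightarrow> nat \<Rightarrow> bool" where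
  "sat_P P m par r \<longleftrightarrow> (\<forall>v\<in>{1..m}. card (tree_children m par r v) \<in> P)"

text \<open>Number of P-trees on [m] of height at most h (h an integer, so h = -1 allowed).\<close>
definition n_trees_le :: "nat set \<Rightarrow> int \<Rightarrow> nat \<Rightarrow> nat" where
  "n_trees_le P h m = card {(par, r). rooted_tree m par r \<and> sat_P P m par r
                                      \<and> int (tree_height m par r) \<le> h}"

definition n_trees :: "nat set \<Rightarrow> nat \<Rightarrow> nat" where
  "n_trees P m = card {(par, r). rooted_tree m par r \<and> sat_P P m par r}"

definition T_le :: "nat set \<Rightarrow> int \<Rightarrow> 'a::comm_ring_1 fps" where
  "T_le P h = egf (n_trees_le P h)"

definition T_all :: "nat set \<Rightarrow> 'a::comm_ring_1 fps" where
  "T_all P = egf (n_trees P)"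

definition Ffun :: "nat set \<Rightarrow> nat \<Rightarrow> (nat \<Rightarrow> nat) set" where
  "Ffun P n = {f \<in> {1..n} \<rightarrow>\<^sub>E {1..n}.
                  \<forall>x\<in>{1..n}. card {y \<in> {1..n}. f y = x} \<in> P}"

definition Qfun :: "nat set \<Rightarrow> nat \<Rightarrow> (nat \<Rightarrow> nat option) set" where
  "Qfun P n = {f. dom f \<subseteq> {1..n} \<and> ran f \<subseteq> {1..n} \<and>
                  (\<forall>x\<in>{1..n}. card {y \<in> {1..n}. f y = Some x} \<in> P)}"

primrec piter :: "(nat \<Rightarrow> nat option) \<Rightarrow> nat \<Rightarrow> nat \<Rightarrow> nat option" where
  "piter f 0 x = Some x"
| "piter f (Suc k) x = Option.bind (piter f k x) f"

definition F_egf :: "nat set \<Rightarrow> 'a::comm_ring_1 fps" where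
  "F_egf P = egf (\<lambda>n. card (Ffun P n))"

text \<open>Bivariate series in u and z: fps in z with polynomial (in u) coefficients.\<close>
definition Fk :: "nat \<Rightarrow> nat set \<Rightarrow> 'a::comm_ring_1 poly fps" where
  "Fk k P = Abs_fps (\<lambda>n. \<Sum>f\<in>Ffun P n.
              monom (qinv (fact n)) (n - card ((f ^^ k) ` {1..n})))"

definition Pk :: "nat \<Rightarrow> nat set \<Rightarrow> 'a::comm_ring_1 poly fps" where
  "Pk k P = Abs_fps (\<lambda>n. \<Sum>f\<in>Qfun P n.
              monom (qinv (fact n)) (n - card {y. \<exists>x\<in>{1..n}. piter f k x = Some y}))"

definition dpoly_at1 :: "'a::comm_ring_1 poly \<Rightarrow> 'a" where
  "dpoly_at1 p = (\<Sum>i\<le>degree p. of_nat i * coeff p i)"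

definition du_at1 :: "'a::comm_ring_1 poly fps \<Rightarrow> 'a fps" where
  "du_at1 G = Abs_fps (\<lambda>n. dpoly_at1 (fps_nth G n))"

definition Xi :: "nat \<Rightarrow> nat set \<Rightarrow> 'a::comm_ring_1 fps" where
  "Xi k P = du_at1 (Fk k P)"

definition Xi_partial :: "nat \<Rightarrow> nat set \<Rightarrow> 'a::comm_ring_1 fps" where
  "Xi_partial k P = du_at1 (Pk k P)"

end

theory Submission
  imports Defs
begin

text \<open>
  A point \<open>x\<close> lies outside the image of \<open>f\<^sup>k\<close> iff it is not periodic and the tree of its iterated
  preimages has height less than \<open>k\<close>. Cutting that tree off leaves an arbitrary map from
  \<open>W \<union> {x}\<close> to \<open>W\<close>, where \<open>W\<close> is the set of points outside the tree, with the same constraint on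
  the fibres. Writing \<open>\<phi> = e\<^sub>P\<close> and encoding totality of the maps by \<open>H = 1\<close>, partiality by
  \<open>H = e\<^sup>z\<close>, the number of such maps with \<open>|W| = n\<close> is \<open>n!\<close> times \<open>[w\<^sup>n] (H \<phi>\<^sup>n)'\<close>. Hence both series are
  \<open>T\<^bsub>\<le>k-1\<^esub> \<cdot> \<Sum> z\<^sup>n [w\<^sup>n] (H \<phi>\<^sup>n)'\<close>. Cutting off the tree below an undefined point of a partial map gives
  the Lagrange inversion formula \<open>\<Sum> z\<^sup>n [w\<^sup>n] H \<phi>\<^sup>n = H(T) F\<close>. If \<open>0 \<in> P\<close> then \<open>\<phi>\<close> is invertible, and
  with \<open>h = H/\<phi>\<close> the sum above is the derivative of \<open>h(T) F\<close>; if \<open>0 \<notin> P\<close> there are no trees and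
  everything vanishes.
\<close>

unbundle fps_syntax

section \<open>Composition of formal power series over a commutative ring\<close>

lemma fps_power_nth_eq_0:
  fixes c :: "'a::comm_ring_1 fps"
  assumes "c $ 0 = 0" "n < i"
  shows "(c ^ i) $ n = 0"
  using assms by (simp add: startsby_zero_power_prefix)

text \<open>Since \<open>c\<close> has no constant term, the powers \<open>c ^ i\<close> with
  \<open>i > n\<close> vanish up to degree \<open>n\<close>, so the sum may stop at any
  \<open>N \<ge> n\<close>. Identities about composition thus become identities of finite sums, and
  zero divisors do no harm.\<close>

lemma fps_compose_nth_mult:
  fixes a b c :: "'a::comm_ring_1 fps"
  assumes "c $ 0 = 0" "n \<le> N"
  shows "((a oo c) * b) $ n = (\<Sum>i\<le>N. a $ i * (c ^ i * b) $ n)"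
proof -
  have *: "(a oo c) $ m = (\<Sum>i\<le>N. a $ i * (c ^ i) $ m)" if "m \<le> n" for m
    unfolding fps_compose_nth atMost_atLeast0
    by (rule sum.mono_neutral_left) (use that assms in \<open>auto simp: fps_power_nth_eq_0\<close>)
  have "((a oo c) * b) $ n = (\<Sum>m=0..n. (\<Sum>i\<le>N. a $ i * (c ^ i) $ m) * b $ (n - m))"
    by (simp add: fps_mult_nth *)
  also have "\<dots> = (\<Sum>i\<le>N. a $ i * (c ^ i * b) $ n)"
    unfolding sum_distrib_right fps_mult_nth sum_distrib_left
    by (subst sum.swap) (simp add: mult.assoc)
  finally show ?thesis .
qed

lemma fps_compose_X_mult:
  fixes a c :: "'a::comm_ring_1 fps"
  assumes "c $ 0 = 0"
  shows "(fps_X * a) oo c = c * (a oo c)"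
proof (rule fps_ext)
  fix n
  have "((fps_X * a) oo c) $ n = (\<Sum>i\<le>Suc n. (fps_X * a) $ i * (c ^ i) $ n)"
    using fps_compose_nth_mult[OF assms, of n "Suc n" "fps_X * a" 1] by simp
  also have "\<dots> = (\<Sum>i\<le>n. a $ i * (c ^ i * c) $ n)"
    by (subst sum.atMost_Suc_shift) (simp add: mult.commute)
  also have "\<dots> = (c * (a oo c)) $ n"
    using fps_compose_nth_mult[OF assms, of n n a c] by (simp add: mult.commute)
  finally show "((fps_X * a) oo c) $ n = (c * (a oo c)) $ n" .
qed

lemma fps_compose_X_power_mult:
  fixes a c :: "'a::comm_ring_1 fps"
  assumes "c $ 0 = 0"
  shows "(fps_X ^ i * a) oo c = c ^ i * (a oo c)"
  by (induction i) (simp_all add: fps_compose_X_mult[OF assms] mult.assoc)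

lemma fps_compose_const_mult:
  fixes a c :: "'a::comm_ring_1 fps"
  shows "(fps_const k * a) oo c = fps_const k * (a oo c)"
  by (rule fps_ext) (simp add: fps_compose_nth sum_distrib_left mult.assoc)

lemma fps_eq_sum_plus_tail:
  fixes a :: "'a::comm_ring_1 fps"
  obtains r where "a = (\<Sum>i\<le>n. fps_const (a $ i) * fps_X ^ i) + fps_X ^ Suc n * r"
proof
  show "a = (\<Sum>i\<le>n. fps_const (a $ i) * fps_X ^ i) + fps_X ^ Suc n * fps_shift (Suc n) a"
    by (rule fps_ext)
       (auto simp: fps_sum_nth fps_X_power_nth fps_X_power_mult_nth mult_delta_right
             simp del: power_Suc)
qed

text \<open>For coefficient \<open>n\<close>, split \<open>a\<close> into a polynomial of degree at
  most \<open>n\<close> and a multiple of \<open>fps_X ^ Suc n\<close>. Linearity handles the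
  polynomial; the tail becomes a multiple of \<open>c ^ Suc n\<close>, which has no term of degree
  \<open>n\<close>.\<close>

lemma fps_compose_mult_distrib_comm_ring:
  fixes a b c :: "'a::comm_ring_1 fps"
  assumes "c $ 0 = 0"
  shows "(a * b) oo c = (a oo c) * (b oo c)"
proof (rule fps_ext)
  fix n
  obtain r where r: "a = (\<Sum>i\<le>n. fps_const (a $ i) * fps_X ^ i) + fps_X ^ Suc n * r"
    using fps_eq_sum_plus_tail .
  have "(a * b) oo c = ((\<Sum>i\<le>n. fps_const (a $ i) * (fps_X ^ i * b)) + fps_X ^ Suc n * (r * b)) oo c"
    by (subst r) (simp add: algebra_simps sum_distrib_left del: power_Suc)
  also have "\<dots> = (\<Sum>i\<le>n. fps_const (a $ i) * (c ^ i * (b oo c))) + c ^ Suc n * ((r * b) oo c)"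
    by (simp only: fps_compose_add_distrib fps_compose_sum_distrib fps_compose_const_mult
          fps_compose_X_power_mult[OF assms])
  finally have "((a * b) oo c) $ n = (\<Sum>i\<le>n. a $ i * (c ^ i * (b oo c)) $ n) + (c ^ Suc n * ((r * b) oo c)) $ n"
    by (simp add: fps_sum_nth)
  also have "(c ^ Suc n * ((r * b) oo c)) $ n = 0"
    unfolding fps_mult_nth by (rule sum.neutral) (auto simp: fps_power_nth_eq_0[OF assms] simp del: power_Suc)
  finally show "((a * b) oo c) $ n = ((a oo c) * (b oo c)) $ n"
    using fps_compose_nth_mult[OF assms, of n n a "b oo c"] by simp
qed

text \<open>Termwise differentiation: the derivative of \<open>c ^ Suc i\<close> brings out the
  factor \<open>i + 1\<close>, which an index shift moves into the coefficients of
  \<open>fps_deriv a\<close>.\<close>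

lemma fps_compose_deriv_comm_ring:
  fixes a c :: "'a::comm_ring_1 fps"
  assumes "c $ 0 = 0"
  shows "fps_deriv (a oo c) = (fps_deriv a oo c) * fps_deriv c"
proof (rule fps_ext)
  fix n
  have power: "fps_deriv (c ^ Suc i) $ n = of_nat (Suc i) * (c ^ i * fps_deriv c) $ n" for i
    by (simp only: fps_deriv_power mult.assoc fps_mult_left_const_nth diff_Suc_1)
       (simp add: mult.commute)
  have "fps_deriv (a oo c) $ n = (\<Sum>i\<le>Suc n. a $ i * fps_deriv (c ^ i) $ n)"
    using fps_compose_nth_mult[OF assms, of "n + 1" "Suc n" a 1]
    by (simp add: sum_distrib_left mult_ac del: sum.atMost_Suc of_nat_Suc)
  also have "\<dots> = (\<Sum>i\<le>n. fps_deriv a $ i * (c ^ i * fps_deriv c) $ n)"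
    by (subst sum.atMost_Suc_shift)
       (simp add: power mult_ac del: of_nat_Suc power_Suc fps_deriv_nth, simp add: mult_ac)
  also have "\<dots> = ((fps_deriv a oo c) * fps_deriv c) $ n"
    using fps_compose_nth_mult[OF assms, of n n "fps_deriv a" "fps_deriv c"] by simp
  finally show "fps_deriv (a oo c) $ n = ((fps_deriv a oo c) * fps_deriv c) $ n" .
qed

section \<open>Lagrange inversion through diagonal coefficients\<close>

text \<open>The series side of Lagrange inversion: if \<open>T = X * (\<phi> oo T)\<close>, it is
  the expansion of \<open>(H oo T) / (1 - X * (\<phi>' oo T))\<close>.\<close>

definition diag :: "'a::comm_ring_1 fps \<Rightarrow> 'a fps \<Rightarrow> 'a fps" where
  "diag \<phi> H = Abs_fps (\<lambda>n. (H * \<phi> ^ n) $ n)"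

text \<open>\<open>diag \<phi>\<close> is linear and its coefficient \<open>n\<close> involves
  \<open>H\<close> only up to degree \<open>n\<close>, so its values on monomials determine it. The
  case \<open>s = 0\<close> identifies \<open>F\<close> as the diagonal of \<open>1\<close>.\<close>

lemma diag_eq_compose:
  fixes T F :: "'a::comm_ring_1 fps"
  assumes "T $ 0 = 0" and "\<And>s. diag \<phi> (fps_X ^ s) = T ^ s * F"
  shows "diag \<phi> H = (H oo T) * F"
proof (rule fps_ext)
  fix n
  have "((H oo T) * F) $ n = (\<Sum>i\<le>n. H $ i * (fps_X ^ i * \<phi> ^ n) $ n)"
    by (subst fps_compose_nth_mult[OF assms(1) order_refl], subst assms(2)[symmetric])
       (simp add: diag_def)
  also have "\<dots> = (H * \<phi> ^ n) $ n"
    unfolding fps_mult_nth[of H] by (simp add: fps_X_power_mult_nth atMost_atLeast0)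
  finally show "diag \<phi> H $ n = ((H oo T) * F) $ n"
    by (simp add: diag_def)
qed

lemma rat_ring_cancel:
  assumes "rat_ring TYPE('a::comm_ring_1)" "n > 0" "of_nat n * (a::'a) = of_nat n * b"
  shows "a = b"
proof -
  obtain y :: 'a where "of_nat n * y = 1"
    using assms by (auto simp: rat_ring_def)
  then show ?thesis
    using assms(3) by (metis mult.left_commute mult.right_neutral)
qed

text \<open>The values on monomials are the only link between \<open>\<phi>\<close>,
  \<open>T\<close> and \<open>F\<close>: the functional equation of \<open>T\<close> and the closed
  form of \<open>F\<close> are extracted from them and then differentiated.\<close>

lemma diag_deriv:
  fixes T F \<phi> H :: "'a::comm_ring_1 fps"
  assumes ring: "rat_ring TYPE('a)" and T0: "T $ 0 = 0" and \<phi>0: "\<phi> $ 0 = 1"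
    and diag: "\<And>s. diag \<phi> (fps_X ^ s) = T ^ s * F"
  shows "Abs_fps (\<lambda>n. fps_deriv (H * \<phi> ^ n) $ n) =
    fps_X * (H oo T) * (fps_deriv (fps_deriv \<phi>) oo T) * F ^ 3 + (fps_deriv H oo T) * F ^ 2"
proof -
  note L = diag_eq_compose[OF T0 diag]
  define a where "a = fps_X * (fps_deriv \<phi> oo T)"
  \<comment> \<open>Coefficient \<open>m\<close> of the derivative of \<open>\<phi> ^ Suc m\<close>
    is \<open>m + 1\<close> times coefficient \<open>m + 1\<close> of \<open>\<phi> ^ Suc m\<close>,
    and also \<open>m + 1\<close> times coefficient \<open>m\<close> of
    \<open>\<phi>' * \<phi> ^ m\<close>; the factor \<open>m + 1\<close> cancels.\<close>
  have "F = 1 + a * F"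
  proof (rule fps_ext)
    fix n
    show "F $ n = (1 + a * F) $ n"
    proof (cases n)
      case 0
      then show ?thesis
        using arg_cong[OF diag[of 0], of "\<lambda>f. f $ 0"] by (simp add: a_def diag_def)
    next
      case (Suc m)
      have "of_nat (Suc m) * (fps_deriv \<phi> * \<phi> ^ m) $ m = of_nat (Suc m) * (\<phi> ^ Suc m) $ Suc m"
        using arg_cong[OF fps_deriv_power[of \<phi> "Suc m"], of "\<lambda>f. f $ m"]
        by (simp add: mult.assoc del: of_nat_Suc power_Suc)
      then have "(fps_deriv \<phi> * \<phi> ^ m) $ m = (\<phi> ^ Suc m) $ Suc m"
        by (rule rat_ring_cancel[OF ring, rotated]) simp
      then have "(a * F) $ Suc m = diag \<phi> 1 $ Suc m"
        unfolding a_def mult.assoc L[of "fps_deriv \<phi>", symmetric]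
        by (simp add: diag_def)
      then show ?thesis
        using diag[of 0] Suc by simp
    qed
  qed
  then have Fa: "F * (1 - a) = 1"
    by (simp add: algebra_simps)
  \<comment> \<open>The case \<open>s = 1\<close>: coefficient \<open>n + 1\<close> of
    \<open>X * \<phi> ^ Suc n\<close> is coefficient \<open>n\<close> of
    \<open>\<phi> * \<phi> ^ n\<close>. As \<open>F\<close> is a unit, it can then be
    cancelled.\<close>
  have "fps_X * (\<phi> oo T) * F = T * F"
  proof (rule fps_ext)
    fix n
    show "(fps_X * (\<phi> oo T) * F) $ n = (T * F) $ n"
      unfolding mult.assoc L[of \<phi>, symmetric]
      using arg_cong[OF diag[of 1], of "\<lambda>f. f $ n"] T0 by (cases n) (simp_all add: diag_def)
  qed
  then have TX: "T = fps_X * (\<phi> oo T)"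
    using Fa by (metis mult.assoc mult.right_neutral)
  \<comment> \<open>Differentiate the functional equation and solve for the derivative; dividing by
    \<open>1 - a\<close> means multiplying by \<open>F\<close>.\<close>
  have T': "fps_deriv T = (\<phi> oo T) * F"
  proof -
    have "fps_deriv T = (\<phi> oo T) + a * fps_deriv T"
      by (subst TX) (simp add: fps_compose_deriv_comm_ring[OF T0] a_def mult_ac)
    then have "fps_deriv T * (1 - a) = (\<phi> oo T)"
      by (simp add: algebra_simps)
    then show ?thesis
      using Fa by (metis mult.assoc mult.commute mult.right_neutral)
  qed
  have F': "fps_deriv F = F ^ 2 * ((fps_deriv \<phi> oo T) + fps_X * (fps_deriv (fps_deriv \<phi>) oo T) * (\<phi> oo T) * F)"
  proof -
    have "fps_deriv F * (1 - a) = F * fps_deriv a"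
      using arg_cong[OF Fa, of fps_deriv] by (simp add: algebra_simps)
    then have "fps_deriv F = F ^ 2 * fps_deriv a"
      using Fa by (metis mult.assoc mult.commute mult.right_neutral power2_eq_square)
    then show ?thesis
      by (simp add: a_def fps_compose_deriv_comm_ring[OF T0] T' algebra_simps)
  qed
  \<comment> \<open>Factoring one \<open>\<phi>\<close> out of \<open>H\<close> turns the left-hand side into the derivative of a diagonal.\<close>
  define h where "h = H * fps_left_inverse \<phi> 1"
  have H: "H = h * \<phi>"
    using fps_left_inverse[of 1 \<phi>] \<phi>0 by (simp add: h_def mult.assoc)
  have "Abs_fps (\<lambda>n. fps_deriv (H * \<phi> ^ n) $ n) = fps_deriv (diag \<phi> h)"
    by (rule fps_ext) (simp add: H diag_def mult.assoc del: fps_deriv_mult)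
  also have "\<dots> = (fps_deriv h oo T) * (\<phi> oo T) * F ^ 2 + (h oo T) * fps_deriv F"
    by (simp add: L fps_compose_deriv_comm_ring[OF T0] T' algebra_simps power2_eq_square)
  \<comment> \<open>The \<open>\<phi>'\<close> summand of the derivative of \<open>F\<close>
    completes \<open>h' * \<phi>\<close> to \<open>H'\<close>; in the \<open>\<phi>''\<close>
    summand, \<open>h * \<phi>\<close> combines to \<open>H\<close>.\<close>
  also have "\<dots> = fps_X * (H oo T) * (fps_deriv (fps_deriv \<phi>) oo T) * F ^ 3 + (fps_deriv H oo T) * F ^ 2"
    unfolding H F' fps_deriv_mult fps_compose_add_distrib fps_compose_mult_distrib_comm_ring[OF T0]
    by (simp add: algebra_simps power2_eq_square power3_eq_cube)
  finally show ?thesis .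
qed

section \<open>Exponential generating functions\<close>

lemma of_nat_mult_qinv:
  assumes "rat_ring TYPE('a::comm_ring_1)" "n > 0"
  shows "of_nat n * (qinv n :: 'a) = 1"
  unfolding qinv_def
proof (rule theI')
  obtain y :: 'a where "of_nat n * y = 1"
    using assms by (auto simp: rat_ring_def)
  then show "\<exists>!y::'a. of_nat n * y = 1"
    using rat_ring_cancel[OF assms] by metis
qed

lemma eq_of_nat_mult_if_mult_qinv_eq:
  assumes "rat_ring TYPE('a::comm_ring_1)" "n > 0" "a * qinv n = (b :: 'a)"
  shows "a = of_nat n * b"
  using of_nat_mult_qinv[OF assms(1,2)] assms(3) by (metis mult.left_commute mult.right_neutral)

lemma fps_deriv_eP:
  assumes ring: "rat_ring TYPE('a::comm_ring_1)"
  shows "fps_deriv (eP P :: 'a fps) = eP (shiftP P 1)"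
proof (rule fps_ext)
  fix n
  have "of_nat (fact n) * (of_nat (Suc n) * qinv (fact (Suc n))) = (of_nat (fact (Suc n)) * qinv (fact (Suc n)) :: 'a)"
    by (simp only: fact_Suc of_nat_mult of_nat_id mult_ac)
  also have "\<dots> = of_nat (fact n) * qinv (fact n)"
    using of_nat_mult_qinv[OF ring, of "fact n"] of_nat_mult_qinv[OF ring, of "fact (Suc n)"]
    by (simp del: fact_Suc)
  finally have "of_nat (fact n) * (of_nat (Suc n) * qinv (fact (Suc n))) = (of_nat (fact n) * qinv (fact n) :: 'a)" .
  then have "of_nat (Suc n) * qinv (fact (Suc n)) = (qinv (fact n) :: 'a)"
    by (rule rat_ring_cancel[OF ring, rotated]) simp
  moreover have "n \<in> shiftP P 1 \<longleftrightarrow> Suc n \<in> P"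
    unfolding shiftP_def by (force simp: Suc_le_eq)
  ultimately show "fps_deriv (eP P :: 'a fps) $ n = eP (shiftP P 1) $ n"
    by (simp add: eP_def del: of_nat_Suc fact_Suc)
qed

lemma mem_shiftP_iff: "m \<in> shiftP P i \<longleftrightarrow> m + i \<in> P"
  by (auto simp: shiftP_def intro!: exI[of _ "m + i"])

lemma shiftP_shiftP: "shiftP (shiftP P i) j = shiftP P (i + j)"
  by (auto simp: mem_shiftP_iff add_ac)

lemma sum_Pow_card:
  fixes h :: "nat \<Rightarrow> 'b::comm_semiring_1"
  assumes "finite U"
  shows "(\<Sum>C\<in>Pow U. h (card C)) = (\<Sum>i\<le>card U. of_nat (card U choose i) * h i)"
proof -
  have "(\<Sum>C\<in>Pow U. h (card C)) = (\<Sum>i\<le>card U. \<Sum>C\<in>{C\<in>Pow U. card C = i}. h (card C))"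
    by (rule sum.group[symmetric]) (use assms in \<open>auto intro: card_mono\<close>)
  also have "\<dots> = (\<Sum>i\<le>card U. of_nat (card U choose i) * h i)"
  proof (rule sum.cong[OF refl])
    fix i
    have "(\<Sum>C\<in>{C\<in>Pow U. card C = i}. h (card C)) = of_nat (card {C\<in>Pow U. card C = i}) * h i"
      by simp
    then show "(\<Sum>C\<in>{C\<in>Pow U. card C = i}. h (card C)) = of_nat (card U choose i) * h i"
      using n_subsets[OF assms, of i] by simp
  qed
  finally show ?thesis .
qed

text \<open>The product rule for exponential generating functions, for weights on the subsets of any
  finite set that depend only on the size. The factorials cancel because
  \<open>(n choose i) * i! * (n - i)! = n!\<close>.\<close>

lemma subset_convolution:
  fixes t c :: "'b set \<Rightarrow> 'a::comm_ring_1"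
  assumes ring: "rat_ring TYPE('a)" and V: "finite V"
    and t: "\<And>B. B \<subseteq> V \<Longrightarrow> t B * qinv (fact (card B)) = a $ card B"
    and c: "\<And>B. B \<subseteq> V \<Longrightarrow> c B * qinv (fact (card B)) = b $ card B"
  shows "(\<Sum>B\<in>Pow V. t B * c (V - B)) * qinv (fact (card V)) = (a * b) $ card V"
proof -
  let ?n = "card V"
  have "(\<Sum>B\<in>Pow V. t B * c (V - B)) =
      (\<Sum>B\<in>Pow V. of_nat (fact (card B)) * a $ card B * (of_nat (fact (?n - card B)) * b $ (?n - card B)))"
  proof (rule sum.cong[OF refl])
    fix B assume "B \<in> Pow V"
    then have B: "B \<subseteq> V" "V - B \<subseteq> V" "card (V - B) = ?n - card B"
      using V by (auto intro: card_Diff_subset finite_subset)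
    show "t B * c (V - B) =
        of_nat (fact (card B)) * a $ card B * (of_nat (fact (?n - card B)) * b $ (?n - card B))"
      using eq_of_nat_mult_if_mult_qinv_eq[OF ring _ t[OF B(1)]]
        eq_of_nat_mult_if_mult_qinv_eq[OF ring _ c[OF B(2)]] B(3) by simp
  qed
  also have "\<dots> = (\<Sum>i\<le>?n. of_nat (?n choose i) *
      (of_nat (fact i) * a $ i * (of_nat (fact (?n - i)) * b $ (?n - i))))"
    by (rule sum_Pow_card[OF V])
  also have "\<dots> = (\<Sum>i\<le>?n. of_nat (fact ?n) * (a $ i * b $ (?n - i)))"
  proof (rule sum.cong[OF refl])
    fix i assume "i \<in> {..?n}"
    then have "fact i * fact (?n - i) * (?n choose i) = fact ?n"
      by (simp add: binomial_fact_lemma)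
    then have "of_nat (fact ?n) = (of_nat (?n choose i) * of_nat (fact i) * of_nat (fact (?n - i)) :: 'a)"
      by (metis mult.assoc mult.commute of_nat_mult)
    then show "of_nat (?n choose i) * (of_nat (fact i) * a $ i * (of_nat (fact (?n - i)) * b $ (?n - i))) =
        of_nat (fact ?n) * (a $ i * b $ (?n - i))"
      by (simp only: mult_ac)
  qed
  also have "\<dots> = of_nat (fact ?n) * (a * b) $ ?n"
    by (simp add: fps_mult_nth sum_distrib_left atMost_atLeast0)
  finally show ?thesis
    using of_nat_mult_qinv[OF ring, of "fact ?n"]
    by (simp add: mult.commute flip: mult.assoc)
qed

section \<open>Counting partial maps by fibre sizes\<close>

definition pmaps :: "nat set \<Rightarrow> nat set \<Rightarrow> (nat \<Rightarrow> nat option) set" where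
  "pmaps U W = {f. dom f \<subseteq> U \<and> ran f \<subseteq> W}"

text \<open>\<open>E\<close> constrains the number of points of \<open>U\<close> without a value: \<open>E = {0}\<close> gives total
  functions, \<open>E = UNIV\<close> all partial ones.\<close>
definition fmaps :: "nat set \<Rightarrow> nat set \<Rightarrow> nat set \<Rightarrow> nat set \<Rightarrow> (nat \<Rightarrow> nat option) set" where
  "fmaps E P U W = {f \<in> pmaps U W. card (U - dom f) \<in> E \<and> (\<forall>v\<in>W. card {y. f y = Some v} \<in> P)}"

lemma finite_pmaps:
  assumes "finite U" "finite W"
  shows "finite (pmaps U W)"
proof (rule finite_subset)
  show "pmaps U W \<subseteq> (\<Union>D\<in>Pow U. {f. dom f = D \<and> ran f \<subseteq> W})"
    by (auto simp: pmaps_def)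
  show "finite (\<Union>D\<in>Pow U. {f. dom f = D \<and> ran f \<subseteq> W})"
    using assms by (auto intro: finite_set_of_finite_maps finite_subset)
qed

lemma finite_fmaps: "finite U \<Longrightarrow> finite W \<Longrightarrow> finite (fmaps E P U W)"
  by (simp add: fmaps_def finite_pmaps)

text \<open>A map into \<open>insert w W\<close> amounts to the fibre \<open>C\<close> of
  \<open>w\<close> and a map from \<open>U - C\<close> to \<open>W\<close>. Both maps miss the same
  points, so the constraint \<open>E\<close> passes through.\<close>

lemma card_fmaps_insert:
  assumes "finite U" "finite W" "w \<notin> W"
  shows "card (fmaps E P U (insert w W)) =
    (\<Sum>C\<in>Pow U. (if card C \<in> P then 1 else 0) * card (fmaps E P (U - C) W))"
proof -
  let ?S = "SIGMA C:{C\<in>Pow U. card C \<in> P}. fmaps E P (U - C) W"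
  let ?join = "\<lambda>(C, g) y. if y \<in> C then Some w else g y"
  let ?split = "\<lambda>f. ({y. f y = Some w}, f |` {y. f y \<noteq> Some w})"
  have nw: "g y \<noteq> Some w" if "g \<in> fmaps E P U' W" for g y U'
    using that assms(3) by (auto simp: fmaps_def pmaps_def ran_def)
  have "bij_betw ?join ?S (fmaps E P U (insert w W))"
  proof (rule bij_betw_byWitness[where f' = ?split])
    show "\<forall>p\<in>?S. ?split (?join p) = p"
    proof
      fix p assume "p \<in> ?S"
      then obtain C g where p: "p = (C, g)" "g \<in> fmaps E P (U - C) W"
        by auto
      then have "g y = None" if "y \<in> C" for y
        using that by (auto simp: fmaps_def pmaps_def dom_def)
      then show "?split (?join p) = p"
        using nw[OF p(2)] by (auto simp: p(1) restrict_map_def)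
    qed
    show "\<forall>f\<in>fmaps E P U (insert w W). ?join (?split f) = f"
      by (auto simp: restrict_map_def fun_eq_iff)
    show "?join ` ?S \<subseteq> fmaps E P U (insert w W)"
    proof
      fix f assume "f \<in> ?join ` ?S"
      then obtain C g where f: "f = ?join (C, g)" "g \<in> fmaps E P (U - C) W" "C \<subseteq> U" "card C \<in> P"
        by auto
      have "dom f = dom g \<union> C"
        using f(1) by (auto simp: dom_def)
      then have "U - dom f = U - C - dom g" "dom f \<subseteq> U"
        using f(2,3) by (auto simp: fmaps_def pmaps_def)
      moreover have "ran f \<subseteq> insert w W"
        using f(1,2) by (auto simp: fmaps_def pmaps_def ran_def split: if_splits)
      moreover have "{y. f y = Some w} = C"
        using f(1) nw[OF f(2)] by auto
      moreover have "{y. f y = Some v} = {y. g y = Some v}" if "v \<in> W" for v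
        using that assms(3) f by (force simp: fmaps_def pmaps_def)
      ultimately show "f \<in> fmaps E P U (insert w W)"
        using f by (auto simp: fmaps_def pmaps_def)
    qed
    show "?split ` fmaps E P U (insert w W) \<subseteq> ?S"
    proof
      fix p assume "p \<in> ?split ` fmaps E P U (insert w W)"
      then obtain f where f: "p = ?split f" "f \<in> fmaps E P U (insert w W)"
        by blast
      let ?g = "f |` {y. f y \<noteq> Some w}" and ?C = "{y. f y = Some w}"
      have "U - ?C - dom ?g = U - dom f"
        by (auto simp: restrict_map_def dom_def split: if_splits)
      moreover have "{y. ?g y = Some v} = {y. f y = Some v}" if "v \<in> W" for v
        using that assms(3) by (auto simp: restrict_map_def)
      moreover have "dom ?g \<subseteq> U - ?C" "ran ?g \<subseteq> W" "?C \<subseteq> U"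
        using f(2) by (auto simp: fmaps_def pmaps_def restrict_map_def dom_def ran_def split: if_splits)
      ultimately show "p \<in> ?S"
        using f by (simp add: fmaps_def pmaps_def)
    qed
  qed
  then have "card (fmaps E P U (insert w W)) = card ?S"
    by (rule bij_betw_same_card[symmetric])
  also have "\<dots> = (\<Sum>C\<in>{C\<in>Pow U. card C \<in> P}. card (fmaps E P (U - C) W))"
    using assms by (intro card_SigmaI) (auto intro: finite_fmaps)
  also have "\<dots> = (\<Sum>C\<in>Pow U. (if card C \<in> P then 1 else 0) * card (fmaps E P (U - C) W))"
    by (subst sum.inter_filter) (use assms(1) in \<open>auto intro: sum.cong\<close>)
  finally show ?thesis .
qed

text \<open>The source splits into the set of points without a value, with series
  \<open>eP E\<close>, and one fibre per target, each with series \<open>eP P\<close>. The induction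
  adds one target at a time.\<close>

lemma card_fmaps:
  assumes ring: "rat_ring TYPE('a::comm_ring_1)" and "finite U" "finite W"
  shows "of_nat (card (fmaps E P U W)) * qinv (fact (card U)) = (eP E * eP P ^ card W :: 'a fps) $ card U"
  using assms(3,2)
proof (induction W arbitrary: U rule: finite_induct)
  case empty
  have "fmaps E P U {} = (if card U \<in> E then {Map.empty} else {})"
    if "pmaps U {} = {Map.empty}"
    using that by (auto simp: fmaps_def)
  moreover have "pmaps U {} = {Map.empty}"
    by (auto simp: pmaps_def ran_def fun_eq_iff) (metis option.exhaust)
  ultimately show ?case
    by (simp add: eP_def)
next
  case (insert w W)
  have "of_nat (card (fmaps E P U (insert w W))) * qinv (fact (card U)) =
      (\<Sum>C\<in>Pow U. (if card C \<in> P then 1 else 0) * of_nat (card (fmaps E P (U - C) W))) * (qinv (fact (card U)) :: 'a)"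
    by (simp only: card_fmaps_insert[OF insert.prems insert.hyps] of_nat_sum of_nat_mult of_nat_1 of_nat_0 if_distrib[of of_nat])
  also have "\<dots> = (eP P * (eP E * eP P ^ card W)) $ card U"
    by (rule subset_convolution[OF ring insert.prems, where t = "\<lambda>C. if card C \<in> P then 1 else 0"])
       (simp add: eP_def, rule insert.IH, rule finite_subset[OF _ insert.prems])
  also have "eP P * (eP E * eP P ^ card W) = eP E * eP P ^ card (insert w W)"
    using insert.hyps by (simp add: mult_ac)
  finally show ?case .
qed

section \<open>Cutting off the basin of a point\<close>

lemma piter_add: "piter f (i + j) x = Option.bind (piter f i x) (piter f j)"
  by (induction j) (simp_all add: Option.bind_assoc)

lemma piter_Suc_left: "piter f (Suc k) x = Option.bind (f x) (piter f k)"
  using piter_add[of f 1 k x] by simp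

lemma piter_Suc_eq_SomeE:
  assumes "piter f (Suc k) x = Some y"
  obtains z where "piter f k x = Some z" "f z = Some y"
  using assms by (auto simp: Option.bind_eq_Some_conv)

lemma piter_Suc_left_eq_SomeE:
  assumes "piter f (Suc k) x = Some y"
  obtains z where "f x = Some z" "piter f k z = Some y"
  using assms unfolding piter_Suc_left by (auto simp: Option.bind_eq_Some_conv)

lemma piter_map_le:
  assumes "h \<subseteq>\<^sub>m f" "piter h k x = Some y"
  shows "piter f k x = Some y"
  using assms(2)
proof (induction k arbitrary: y)
  case (Suc k)
  from Suc.prems obtain z where "piter h k x = Some z" "h z = Some y"
    by (rule piter_Suc_eq_SomeE)
  then show ?case
    using Suc.IH[of z] assms(1) by (simp add: map_le_def) (metis domI)
qed simp

text \<open>Equivalently, \<open>f x\<close>, if defined, lies outside the basin of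
  \<open>x\<close>; this is what lets the edge out of \<open>x\<close> be separated from the tree
  below.\<close>

definition aperiodic :: "(nat \<Rightarrow> nat option) \<Rightarrow> nat \<Rightarrow> bool" where
  "aperiodic f x \<longleftrightarrow> (\<forall>j>0. piter f j x \<noteq> Some x)"

lemma aperiodic_if_None: "f x = None \<Longrightarrow> aperiodic f x"
  by (auto simp: aperiodic_def gr0_conv_Suc piter_Suc_left simp del: piter.simps(2))

text \<open>Two different arrival times would differ by a period of \<open>x\<close>. Hence every
  point of the basin has one well-defined depth.\<close>

lemma aperiodic_piter_unique:
  assumes "aperiodic f x" "piter f i v = Some x" "piter f j v = Some x"
  shows "i = j"
proof -
  have "\<not> i < j" if "piter f i v = Some x" "piter f j v = Some x" for i j
  proof
    assume "i < j"
    then have "piter f (j - i) x = Some x"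
      using that piter_add[of f i "j - i" v] by simp
    then show False
      using assms(1) \<open>i < j\<close> by (simp add: aperiodic_def)
  qed
  then show ?thesis
    using assms(2,3) by (metis linorder_neqE_nat)
qed

definition basin :: "(nat \<Rightarrow> nat option) \<Rightarrow> nat \<Rightarrow> nat set" where
  "basin f x = {v. \<exists>j. piter f j v = Some x}"

text \<open>Trees with root \<open>x\<close> and edges pointing towards it. The root gets no value,
  so that cutting a map at \<open>x\<close> leaves the value at \<open>x\<close> to the other
  part.\<close>

definition ptree :: "nat set \<Rightarrow> nat \<Rightarrow> (nat \<Rightarrow> nat option) set" where
  "ptree B x = {h \<in> pmaps B B. dom h = B - {x} \<and> B \<subseteq> basin h x}"

lemma basin_self: "x \<in> basin f x"
  unfolding basin_def by (auto intro: exI[of _ 0])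

lemma basin_step:
  assumes "f v = Some w" "w \<in> basin f x"
  shows "v \<in> basin f x"
proof -
  obtain j where "piter f j w = Some x"
    using assms(2) by (auto simp: basin_def)
  then have "piter f (Suc j) v = Some x"
    using assms(1) by (simp add: piter_Suc_left del: piter.simps(2))
  then show ?thesis
    unfolding basin_def by blast
qed

lemma basin_cases:
  assumes "v \<in> basin f x" "v \<noteq> x"
  obtains w where "f v = Some w" "w \<in> basin f x"
proof -
  obtain j where "piter f j v = Some x"
    using assms(1) by (auto simp: basin_def)
  then show ?thesis
    using that assms(2)
    by (cases j) (auto simp: basin_def piter_Suc_left Option.bind_eq_Some_conv simp del: piter.simps(2))
qed

section \<open>Gluing a tree rooted at \<open>x\<close> to a map that never enters the tree\<close>

context
  fixes x :: nat and B V :: "nat set" and h g :: "nat \<Rightarrow> nat option"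
  assumes x: "x \<in> B" and B: "B \<subseteq> V" and h: "h \<in> ptree B x"
    and g: "g \<in> pmaps (insert x (V - B)) (V - B)"
begin

text \<open>The domains of \<open>h\<close> and \<open>g\<close> are disjoint: \<open>x\<close> is
  excluded from the first and takes its value, if any, from \<open>g\<close>.\<close>

lemma glue_in: "v \<in> B - {x} \<Longrightarrow> (h ++ g) v = h v"
  using g B by (auto simp: pmaps_def map_add_def dom_def split: option.splits)

lemma glue_out: "v \<notin> B - {x} \<Longrightarrow> (h ++ g) v = g v"
  using h by (auto simp: ptree_def map_add_def dom_def split: option.splits)

lemma glue_pmaps: "h ++ g \<in> pmaps V V"
proof -
  have "ran (h ++ g) \<subseteq> ran h \<union> ran g"
    by (auto simp: ran_def map_add_def split: option.splits)
  moreover have "ran h \<union> ran g \<subseteq> V" "dom h \<subseteq> V" "dom g \<subseteq> V"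
    using g h B x by (auto simp: pmaps_def ptree_def)
  ultimately show ?thesis
    unfolding pmaps_def dom_map_add by blast
qed

text \<open>All values of \<open>g\<close> lie outside \<open>B\<close>, so an orbit outside the
  tree never enters it.\<close>

lemma glue_stays_out:
  assumes "v \<in> V - B" "piter (h ++ g) j v = Some w"
  shows "w \<in> V - B"
  using assms(2)
proof (induction j arbitrary: w)
  case 0
  then show ?case
    using assms(1) by simp
next
  case (Suc j)
  from Suc.prems obtain z where z: "piter (h ++ g) j v = Some z" "(h ++ g) z = Some w"
    by (rule piter_Suc_eq_SomeE)
  then have "g z = Some w"
    using Suc.IH[of z] glue_out[of z] by simp
  then show ?case
    using g by (auto simp: pmaps_def ran_def)
qed

lemma glue_aperiodic: "aperiodic (h ++ g) x"
  unfolding aperiodic_def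
proof (intro allI impI notI)
  fix j :: nat
  assume "j > 0" and j: "piter (h ++ g) j x = Some x"
  then obtain i where "j = Suc i"
    using gr0_conv_Suc by blast
  with j obtain w where "(h ++ g) x = Some w" "piter (h ++ g) i w = Some x"
    using piter_Suc_left_eq_SomeE by metis
  moreover from this(1) have "g x = Some w"
    using glue_out[of x] by simp
  then have "w \<in> V - B"
    using g by (auto simp: pmaps_def ran_def)
  ultimately show False
    using glue_stays_out x by blast
qed

lemma tree_map_le_glue: "h \<subseteq>\<^sub>m h ++ g"
  using h glue_in by (auto simp: map_le_def ptree_def)

lemma glue_basin: "basin (h ++ g) x = B"
proof
  show "B \<subseteq> basin (h ++ g) x"
    using h piter_map_le[OF tree_map_le_glue] by (fastforce simp: ptree_def basin_def)
  show "basin (h ++ g) x \<subseteq> B"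
  proof
    fix v assume v: "v \<in> basin (h ++ g) x"
    have "v \<in> V"
    proof (cases "v = x")
      case False
      with v obtain w where "(h ++ g) v = Some w"
        by (rule basin_cases)
      then show ?thesis
        using glue_pmaps by (auto simp: pmaps_def simp del: map_add_Some_iff)
    qed (use x B in auto)
    moreover obtain j where "piter (h ++ g) j v = Some x"
      using v unfolding basin_def by blast
    ultimately show "v \<in> B"
      using glue_stays_out[of v j x] x by blast
  qed
qed

text \<open>A point that reaches \<open>x\<close> lies in the tree and reaches \<open>x\<close>
  within \<open>h\<close> as well; by uniqueness of arrival times both take equally long. So depths,
  and with them height bounds, depend on \<open>h\<close> alone.\<close>

lemma glue_piter_iff: "piter (h ++ g) j v = Some x \<longleftrightarrow> piter h j v = Some x"
proof
  assume f: "piter (h ++ g) j v = Some x"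
  then have "v \<in> B"
    using glue_basin by (auto simp: basin_def)
  then obtain i where i: "piter h i v = Some x"
    using h by (auto simp: ptree_def basin_def)
  then have "i = j"
    using aperiodic_piter_unique[OF glue_aperiodic piter_map_le[OF tree_map_le_glue] f] by simp
  then show "piter h j v = Some x"
    using i by simp
qed (rule piter_map_le[OF tree_map_le_glue])

lemma glue_restrict: "(h ++ g) |` (B - {x}) = h" "(h ++ g) |` (- (B - {x})) = g"
proof -
  have "h v = None" if "v \<notin> B - {x}" for v
    using h that by (auto simp: ptree_def dom_def)
  then show "(h ++ g) |` (B - {x}) = h"
    using glue_in by (auto simp: restrict_map_def fun_eq_iff)
  have "g v = None" if "v \<in> B - {x}" for v
    using g B that by (auto simp: pmaps_def dom_def)
  then show "(h ++ g) |` (- (B - {x})) = g"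
    using glue_out by (auto simp: restrict_map_def fun_eq_iff)
qed

lemma glue_fibre_in:
  assumes "v \<in> B"
  shows "{y. (h ++ g) y = Some v} = {y. h y = Some v}"
proof -
  have "g y \<noteq> Some v" for y
    using assms g by (auto simp: pmaps_def ran_def)
  moreover have "h y \<noteq> Some v" if "y \<notin> B - {x}" for y
    using that h by (auto simp: ptree_def)
  ultimately show ?thesis
    using glue_in glue_out by (intro Collect_cong) metis
qed

lemma glue_fibre_out:
  assumes "v \<in> V - B"
  shows "{y. (h ++ g) y = Some v} = {y. g y = Some v}"
proof -
  have "h y \<noteq> Some v" for y
    using assms h by (auto simp: ptree_def pmaps_def ran_def)
  moreover have "g y \<noteq> Some v" if "y \<in> B - {x}" for y
    using that g B by (auto simp: pmaps_def)
  ultimately show ?thesis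
    using glue_in glue_out by (intro Collect_cong) metis
qed

text \<open>\<open>h\<close> takes values only in \<open>B\<close> and \<open>g\<close> only
  outside, so each fibre is supplied by just one of the two maps.\<close>

lemma glue_fibres:
  "(\<forall>v\<in>V. card {y. (h ++ g) y = Some v} \<in> P) \<longleftrightarrow>
    (\<forall>v\<in>B. card {y. h y = Some v} \<in> P) \<and> (\<forall>v\<in>V-B. card {y. g y = Some v} \<in> P)"
proof -
  have V_eq: "V = B \<union> (V - B)"
    using B by auto
  show ?thesis
    by (subst V_eq, unfold ball_Un) (simp only: glue_fibre_in glue_fibre_out cong: ball_cong)
qed

text \<open>Inside the tree \<open>h\<close> lacks a value only at \<open>x\<close>, so the missing
  values are exactly those of \<open>g\<close>.\<close>

lemma glue_undefined: "V - dom (h ++ g) = insert x (V - B) - dom g"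
  using g h x B by (auto simp: pmaps_def ptree_def)

end

section \<open>Cutting a map at an aperiodic point, the inverse of gluing\<close>

lemma restrict_basin:
  assumes x: "x \<in> V" and f: "f \<in> pmaps V V" and "aperiodic f x"
  defines "B \<equiv> basin f x"
  shows "B \<subseteq> V"
    and "f |` (B - {x}) \<in> ptree B x"
    and "f |` (- (B - {x})) \<in> pmaps (insert x (V - B)) (V - B)"
    and "f |` (B - {x}) ++ f |` (- (B - {x})) = f"
proof -
  have B_step: "\<exists>w\<in>B. f v = Some w" if "v \<in> B - {x}" for v
    using that basin_cases[of v f x] by (auto simp: B_def)
  then show "B \<subseteq> V"
    using x f by (fastforce simp: pmaps_def)
  let ?h = "f |` (B - {x})"
  have dom: "dom ?h = B - {x}"
    using B_step by (auto simp: restrict_map_def dom_def split: if_splits)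
  have "ran ?h \<subseteq> B"
    using B_step by (fastforce simp: ran_def restrict_map_def split: if_splits)
  \<comment> \<open>The restriction has no value at \<open>x\<close>, so a path is followed only up
    to its first visit to \<open>x\<close>; therefore the time \<open>i\<close> is left
    existential.\<close>
  moreover have "\<exists>i. piter ?h i v = Some x" if "piter f j v = Some x" for v j
    using that
  proof (induction j arbitrary: v)
    case 0
    then show ?case
      by (auto intro: exI[of _ 0])
  next
    case (Suc j)
    show ?case
    proof (cases "v = x")
      case True
      then show ?thesis
        by (auto intro: exI[of _ 0])
    next
      case False
      moreover obtain w where w: "f v = Some w" "piter f j w = Some x"
        using piter_Suc_left_eq_SomeE[OF Suc.prems] .
      moreover have "v \<in> B"
        using Suc.prems by (auto simp: B_def basin_def simp del: piter.simps(2))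
      moreover obtain i where "piter ?h i w = Some x"
        using Suc.IH[OF w(2)] by blast
      ultimately have "piter ?h (Suc i) v = Some x"
        by (simp add: piter_Suc_left del: piter.simps(2))
      then show ?thesis ..
    qed
  qed
  ultimately show "?h \<in> ptree B x"
    using dom by (auto simp: ptree_def pmaps_def) (auto simp: basin_def B_def)
  \<comment> \<open>Basins are closed under preimages, so outside \<open>B - {x}\<close> only
    \<open>x\<close> itself could map into \<open>B\<close>, and then \<open>x\<close> would be
    periodic.\<close>
  have "w \<notin> B" if "f v = Some w" "v \<notin> B - {x}" for v w
  proof
    assume "w \<in> B"
    then have "v = x"
      using that basin_step[of f v w x] by (auto simp: B_def)
    moreover obtain j where "piter f j w = Some x"
      using \<open>w \<in> B\<close> by (auto simp: B_def basin_def)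
    ultimately have "piter f (Suc j) x = Some x"
      using that(1) by (simp add: piter_Suc_left del: piter.simps(2))
    then show False
      using \<open>aperiodic f x\<close> by (auto simp: aperiodic_def simp del: piter.simps(2))
  qed
  then have "ran (f |` (- (B - {x}))) \<subseteq> V - B"
    using f by (force simp: pmaps_def restrict_map_def ran_def split: if_splits)
  moreover have "dom (f |` (- (B - {x}))) \<subseteq> insert x (V - B)"
    using f by (auto simp: pmaps_def)
  ultimately show "f |` (- (B - {x})) \<in> pmaps (insert x (V - B)) (V - B)"
    by (simp add: pmaps_def)
  show "?h ++ f |` (- (B - {x})) = f"
  proof
    fix v
    show "(?h ++ f |` (- (B - {x}))) v = f v"
      by (cases "f v"; cases "v \<in> B - {x}") (auto simp: map_add_def restrict_map_def)
  qed
qed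

text \<open>Gluing is a bijection whose inverse consists of the basin and the two restrictions, so a
  property that splits over the two parts is counted by a sum of products over the possible
  basins.\<close>

lemma card_aperiodic_decompose:
  assumes V: "finite V" "x \<in> V"
    and \<Phi>: "\<And>B h g. x \<in> B \<Longrightarrow> B \<subseteq> V \<Longrightarrow> h \<in> ptree B x \<Longrightarrow> g \<in> pmaps (insert x (V - B)) (V - B) \<Longrightarrow>
      \<Phi> (h ++ g) \<longleftrightarrow> \<Phi>1 B h \<and> \<Phi>2 B g"
  shows "card {f \<in> pmaps V V. aperiodic f x \<and> \<Phi> f} =
    (\<Sum>B\<in>{B\<in>Pow V. x \<in> B}. card {h \<in> ptree B x. \<Phi>1 B h} *
      card {g \<in> pmaps (insert x (V - B)) (V - B). \<Phi>2 B g})"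
proof -
  let ?G = "\<lambda>B. {g \<in> pmaps (insert x (V - B)) (V - B). \<Phi>2 B g}"
  let ?H = "\<lambda>B. {h \<in> ptree B x. \<Phi>1 B h}"
  let ?S = "SIGMA B:{B\<in>Pow V. x \<in> B}. ?H B \<times> ?G B"
  let ?F = "{f \<in> pmaps V V. aperiodic f x \<and> \<Phi> f}"
  have "bij_betw (\<lambda>(B, h, g). h ++ g) ?S ?F"
  proof (rule bij_betw_byWitness[where
        f' = "\<lambda>f. (basin f x, f |` (basin f x - {x}), f |` (- (basin f x - {x})))"])
    show "\<forall>p\<in>?S. (\<lambda>f. (basin f x, f |` (basin f x - {x}), f |` (- (basin f x - {x}))))
        ((\<lambda>(B, h, g). h ++ g) p) = p"
      by (auto simp: glue_basin glue_restrict simp del: Compl_Diff_eq)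
    show "\<forall>f\<in>?F. (\<lambda>(B, h, g). h ++ g) (basin f x, f |` (basin f x - {x}), f |` (- (basin f x - {x}))) = f"
      using restrict_basin(4)[OF V(2)] by auto
    show "(\<lambda>(B, h, g). h ++ g) ` ?S \<subseteq> ?F"
      by (auto simp: glue_pmaps glue_aperiodic \<Phi>)
    show "(\<lambda>f. (basin f x, f |` (basin f x - {x}), f |` (- (basin f x - {x})))) ` ?F \<subseteq> ?S"
    proof
      fix p assume "p \<in> (\<lambda>f. (basin f x, f |` (basin f x - {x}), f |` (- (basin f x - {x})))) ` ?F"
      then obtain f where f: "p = (basin f x, f |` (basin f x - {x}), f |` (- (basin f x - {x})))"
        "f \<in> pmaps V V" "aperiodic f x" "\<Phi> f"
        by blast
      note r = restrict_basin[OF V(2) f(2,3)]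
      show "p \<in> ?S"
        using \<Phi>[OF basin_self r(1-3)] r f(4) by (simp add: f(1) basin_self)
    qed
  qed
  then have "card ?F = card ?S"
    by (rule bij_betw_same_card[symmetric])
  also have "\<dots> = (\<Sum>B\<in>{B\<in>Pow V. x \<in> B}. card (?H B \<times> ?G B))"
    using V(1) by (intro card_SigmaI) (auto simp: ptree_def finite_pmaps finite_subset)
  finally show ?thesis
    by (simp add: card_cartesian_product)
qed

section \<open>Labelled trees as partial maps\<close>

text \<open>A tree with root \<open>x\<close> has height less than \<open>k\<close> iff it avoids \<open>{k}\<close>; \<open>K = {}\<close> imposes no bound.\<close>
definition avoids :: "nat set \<Rightarrow> (nat \<Rightarrow> nat option) \<Rightarrow> nat \<Rightarrow> bool" where
  "avoids K f x \<longleftrightarrow> (\<forall>k\<in>K. \<forall>v. piter f k v \<noteq> Some x)"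

definition ptrees :: "nat set \<Rightarrow> nat set \<Rightarrow> nat set \<Rightarrow> (nat \<times> (nat \<Rightarrow> nat option)) set" where
  "ptrees P K B =
    (SIGMA x:B. {h \<in> ptree B x. (\<forall>v\<in>B. card {y. h y = Some v} \<in> P) \<and> avoids K h x})"

lemma finite_ptree: "finite B \<Longrightarrow> finite (ptree B x)"
  by (simp add: ptree_def finite_pmaps)

lemma finite_ptrees: "finite B \<Longrightarrow> finite (ptrees P K B)"
  by (simp add: ptrees_def finite_ptree)

lemma ptree_ranD: "h \<in> ptree B x \<Longrightarrow> h v = Some w \<Longrightarrow> w \<in> B"
  by (auto simp: ptree_def pmaps_def ran_def)

lemma ptree_domD: "h \<in> ptree B x \<Longrightarrow> h v = Some w \<Longrightarrow> v \<in> B - {x}"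
  by (auto simp: ptree_def)

lemma piter_ptree_mem:
  assumes "h \<in> ptree B x" "v \<in> B" "piter h j v = Some w"
  shows "w \<in> B"
proof (cases j)
  case (Suc i)
  then show ?thesis
    using assms by (metis piter_Suc_eq_SomeE ptree_ranD)
qed (use assms in auto)

section \<open>Invariance of tree counts under relabelling\<close>

definition relabel ::
  "(nat \<Rightarrow> nat) \<Rightarrow> nat set \<Rightarrow> (nat \<Rightarrow> nat option) \<Rightarrow> nat \<Rightarrow> nat option" where
  "relabel \<pi> B h w = (if w \<in> \<pi> ` B then map_option \<pi> (h (inv_into B \<pi> w)) else None)"

context
  fixes \<pi> :: "nat \<Rightarrow> nat" and B :: "nat set"
  assumes inj: "inj_on \<pi> B"
begin

lemma relabel_apply: "v \<in> B \<Longrightarrow> relabel \<pi> B h (\<pi> v) = map_option \<pi> (h v)"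
  using inj by (simp add: relabel_def)

context
  fixes h x
  assumes h: "h \<in> ptree B x" and x: "x \<in> B"
begin

lemma relabel_eq_Some_iff:
  assumes "w \<in> B"
  shows "relabel \<pi> B h y = Some (\<pi> w) \<longleftrightarrow> (\<exists>v\<in>B. y = \<pi> v \<and> h v = Some w)"
proof
  assume y: "relabel \<pi> B h y = Some (\<pi> w)"
  then obtain v where v: "v \<in> B" "y = \<pi> v"
    by (auto simp: relabel_def split: if_splits)
  then obtain z where z: "h v = Some z" "\<pi> z = \<pi> w"
    using y by (auto simp: relabel_apply)
  then have "z = w"
    using assms ptree_ranD[OF h z(1)] inj by (auto dest: inj_onD)
  then show "\<exists>v\<in>B. y = \<pi> v \<and> h v = Some w"
    using v z by auto
qed (auto simp: relabel_apply)

lemma relabel_fibre: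
  assumes "w \<in> B"
  shows "card {y. relabel \<pi> B h y = Some (\<pi> w)} = card {y. h y = Some w}"
proof -
  have sub: "{y. h y = Some w} \<subseteq> B"
    using ptree_domD[OF h] by auto
  then have "{y. relabel \<pi> B h y = Some (\<pi> w)} = \<pi> ` {y. h y = Some w}"
    unfolding relabel_eq_Some_iff[OF assms] by auto
  then show ?thesis
    using card_image[OF inj_on_subset[OF inj sub]] by simp
qed

lemma piter_relabel: "v \<in> B \<Longrightarrow> piter (relabel \<pi> B h) j (\<pi> v) = map_option \<pi> (piter h j v)"
proof (induction j)
  case (Suc j)
  then show ?case
    using piter_ptree_mem[OF h Suc.prems, of j] by (cases "piter h j v") (auto simp: relabel_apply)
qed simp

lemma piter_relabel_eq_root:
  "piter (relabel \<pi> B h) j y = Some (\<pi> x) \<longleftrightarrow> (\<exists>v\<in>B. y = \<pi> v \<and> piter h j v = Some x)"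
proof
  assume y: "piter (relabel \<pi> B h) j y = Some (\<pi> x)"
  \<comment> \<open>A relabelled tree has no values outside the image; at time 0 the point is the
    new root, which is in the image.\<close>
  have "y \<in> \<pi> ` B"
  proof (cases j)
    case (Suc i)
    then obtain z where "relabel \<pi> B h y = Some z"
      using y piter_Suc_left_eq_SomeE by metis
    then show ?thesis
      by (auto simp: relabel_def split: if_splits)
  qed (use x y in auto)
  then obtain v where v: "v \<in> B" "y = \<pi> v"
    by auto
  then obtain z where z: "piter h j v = Some z" "\<pi> z = \<pi> x"
    using y by (auto simp: piter_relabel)
  then have "z = x"
    using x piter_ptree_mem[OF h v(1) z(1)] inj by (auto dest: inj_onD)
  then show "\<exists>v\<in>B. y = \<pi> v \<and> piter h j v = Some x"
    using v z by auto
qed (auto simp: piter_relabel)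

lemma avoids_relabel: "avoids K h x \<Longrightarrow> avoids K (relabel \<pi> B h) (\<pi> x)"
  by (auto simp: avoids_def piter_relabel_eq_root)

lemma relabel_ptree: "relabel \<pi> B h \<in> ptree (\<pi> ` B) (\<pi> x)"
proof -
  have "dom (relabel \<pi> B h) = \<pi> ` dom h"
  proof
    show "dom (relabel \<pi> B h) \<subseteq> \<pi> ` dom h"
    proof
      fix y assume y: "y \<in> dom (relabel \<pi> B h)"
      then obtain v where v: "v \<in> B" "y = \<pi> v"
        by (auto simp: relabel_def dom_def split: if_splits)
      then have "v \<in> dom h"
        using y by (auto simp: relabel_apply)
      then show "y \<in> \<pi> ` dom h"
        using v(2) by blast
    qed
    show "\<pi> ` dom h \<subseteq> dom (relabel \<pi> B h)"
      using ptree_domD[OF h] by (auto simp: relabel_apply)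
  qed
  also have "\<dots> = \<pi> ` B - {\<pi> x}"
    using h x inj by (auto simp: ptree_def dest: inj_onD)
  finally have "dom (relabel \<pi> B h) = \<pi> ` B - {\<pi> x}" .
  moreover have "ran (relabel \<pi> B h) \<subseteq> \<pi> ` B"
    using ptree_ranD[OF h] by (auto simp: ran_def relabel_def split: if_splits)
  moreover have "\<pi> ` B \<subseteq> basin (relabel \<pi> B h) (\<pi> x)"
  proof
    fix y assume "y \<in> \<pi> ` B"
    then obtain v where v: "v \<in> B" "y = \<pi> v"
      by blast
    then obtain j where "piter h j v = Some x"
      using h by (auto simp: ptree_def basin_def)
    then have "piter (relabel \<pi> B h) j y = Some (\<pi> x)"
      using v piter_relabel_eq_root by blast
    then show "y \<in> basin (relabel \<pi> B h) (\<pi> x)"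
      unfolding basin_def by blast
  qed
  ultimately show ?thesis
    by (simp add: ptree_def pmaps_def)
qed

end

lemma relabel_inj:
  assumes "h \<in> ptree B x" "h' \<in> ptree B x" "relabel \<pi> B h = relabel \<pi> B h'"
  shows "h = h'"
proof
  fix v
  show "h v = h' v"
  proof (cases "v \<in> B")
    case True
    then have "map_option \<pi> (h v) = map_option \<pi> (h' v)"
      using assms(3) by (metis relabel_apply)
    then show ?thesis
    proof (rule option.inj_map_strong[rotated])
      fix w w' assume "w \<in> set_option (h v)" "w' \<in> set_option (h' v)" "\<pi> w = \<pi> w'"
      then show "w = w'"
        using ptree_ranD[OF assms(1), of v w] ptree_ranD[OF assms(2), of v w'] inj_onD[OF inj] by auto
    qed
  next
    case False
    then show ?thesis
      using ptree_domD[OF assms(1)] ptree_domD[OF assms(2)]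
      by (metis DiffD1 option.exhaust)
  qed
qed

lemma card_ptrees_le_image:
  assumes "finite B"
  shows "card (ptrees P K B) \<le> card (ptrees P K (\<pi> ` B))"
proof (rule card_inj_on_le)
  let ?r = "\<lambda>(x, h). (\<pi> x, relabel \<pi> B h)"
  show "inj_on ?r (ptrees P K B)"
    using inj by (auto simp: ptrees_def inj_on_def intro: relabel_inj)
  show "?r ` ptrees P K B \<subseteq> ptrees P K (\<pi> ` B)"
    by (auto simp: ptrees_def relabel_ptree avoids_relabel relabel_fibre)
  show "finite (ptrees P K (\<pi> ` B))"
    using assms by (simp add: finite_ptrees)
qed

end

text \<open>Relabelling along an injection gives one inequality, and bijections in both directions
  give equality. This size dependence is what \<open>subset_convolution\<close> asks for.\<close>

lemma card_ptrees_cong: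
  assumes "finite B" "finite B'" "card B = card B'"
  shows "card (ptrees P K B) = card (ptrees P K B')"
proof -
  have "card (ptrees P K B) \<le> card (ptrees P K B')" if eq: "finite B" "finite B'" "card B = card B'"
    for B B' :: "nat set"
  proof -
    obtain \<pi> where "bij_betw \<pi> B B'"
      using finite_same_card_bij[OF eq] by blast
    then show ?thesis
      using card_ptrees_le_image[OF _ eq(1)] by (metis bij_betw_def)
  qed
  then show ?thesis
    using assms by (simp add: order_antisym)
qed

section \<open>Comparison of parent maps with partial maps\<close>

lemma depth_less_if_avoids:
  assumes "avoids {k} h x" "piter h d v = Some x"
  shows "d < k"
proof (rule ccontr)
  assume "\<not> d < k"
  \<comment> \<open>For \<open>d \<ge> k\<close>, the point \<open>d - k\<close> steps after
    \<open>v\<close> is exactly \<open>k\<close> steps before \<open>x\<close>.\<close>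
  then have "Option.bind (piter h (d - k) v) (piter h k) = Some x"
    using piter_add[of h "d - k" k v] assms(2) by simp
  then show False
    using assms(1) by (auto simp: avoids_def Option.bind_eq_Some_conv)
qed

definition tree_map :: "nat \<Rightarrow> (nat \<Rightarrow> nat) \<times> nat \<Rightarrow> nat \<times> (nat \<Rightarrow> nat option)" where
  "tree_map m = (\<lambda>(par, r). (r, \<lambda>v. if v \<in> {1..m} \<and> v \<noteq> r then Some (par v) else None))"

lemma piter_imp_funpow:
  assumes "\<And>v w. h v = Some w \<Longrightarrow> par v = w"
  shows "piter h j v = Some w \<Longrightarrow> (par ^^ j) v = w"
proof (induction j arbitrary: w)
  case (Suc j)
  from Suc.prems obtain z where "piter h j v = Some z" "h z = Some w"
    by (rule piter_Suc_eq_SomeE)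
  then show ?case
    using Suc.IH assms by simp
qed simp

context
  fixes m par r h
  assumes tree: "rooted_tree m par r"
    and h: "h = (\<lambda>v. if v \<in> {1..m} \<and> v \<noteq> r then Some (par v) else None)"
begin

text \<open>\<open>par\<close> and \<open>h\<close> agree until the root is reached; afterwards
  \<open>par\<close> stays there while \<open>h\<close> is undefined.\<close>

lemma funpow_imp_piter:
  assumes "v \<in> {1..m}" "\<forall>i<j. (par ^^ i) v \<noteq> r"
  shows "piter h j v = Some ((par ^^ j) v)"
proof -
  have "(par ^^ i) v \<in> {1..m}" for i
    using assms(1) tree by (induction i) (auto simp: rooted_tree_def)
  then show ?thesis
    using assms(2) by (induction j) (auto simp: h)
qed

lemma piter_tree_depth:
  assumes "v \<in> {1..m}"
  shows "piter h (tree_depth par r v) v = Some r"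
proof -
  have "\<exists>j. (par ^^ j) v = r"
    using tree assms by (auto simp: rooted_tree_def)
  then have "(par ^^ tree_depth par r v) v = r"
    unfolding tree_depth_def by (rule LeastI_ex)
  moreover have "\<forall>i<tree_depth par r v. (par ^^ i) v \<noteq> r"
    unfolding tree_depth_def using not_less_Least by blast
  ultimately show ?thesis
    using funpow_imp_piter[OF assms] by metis
qed

lemma tree_map_ptree: "h \<in> ptree {1..m} r"
proof -
  have "dom h = {1..m} - {r}"
    by (auto simp: h dom_def)
  moreover have "ran h \<subseteq> {1..m}"
    using tree by (auto simp: h ran_def rooted_tree_def)
  moreover have "{1..m} \<subseteq> basin h r"
    using piter_tree_depth unfolding basin_def by blast
  ultimately show ?thesis
    by (auto simp: ptree_def pmaps_def)
qed

lemma sat_P_iff: "sat_P P m par r \<longleftrightarrow> (\<forall>v\<in>{1..m}. card {y. h y = Some v} \<in> P)"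
proof -
  have "tree_children m par r v = {y. h y = Some v}" for v
    by (auto simp: tree_children_def h)
  then show ?thesis
    by (simp add: sat_P_def)
qed

text \<open>The path from a vertex of depth at least \<open>k\<close> passes through one of depth
  exactly \<open>k\<close>, so only the iterate \<open>k\<close> matters. For \<open>k = 0\<close>
  both sides are false, in accordance with the bound -1.\<close>

lemma tree_height_less_iff: "int (tree_height m par r) \<le> int k - 1 \<longleftrightarrow> avoids {k} h r"
proof -
  have r: "r \<in> {1..m}" and hr: "h r = None"
    using tree by (auto simp: rooted_tree_def h)
  note aper = aperiodic_if_None[of h r, OF hr]
  have "int (tree_height m par r) \<le> int k - 1 \<longleftrightarrow> tree_height m par r < k"
    by auto
  also have "\<dots> \<longleftrightarrow> (\<forall>v\<in>{1..m}. tree_depth par r v < k)"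
    unfolding tree_height_def by (subst Max_less_iff) (use r in auto)
  also have "\<dots> \<longleftrightarrow> avoids {k} h r"
  proof
    assume L: "\<forall>v\<in>{1..m}. tree_depth par r v < k"
    have "piter h k v \<noteq> Some r" for v
    proof
      assume v: "piter h k v = Some r"
      have "v \<in> {1..m}"
      proof (cases k)
        case (Suc i)
        then obtain z where "h v = Some z"
          using v piter_Suc_left_eq_SomeE by metis
        then show ?thesis
          by (auto simp: h split: if_splits)
      qed (use r v in auto)
      then show False
        using L aperiodic_piter_unique[OF aper v piter_tree_depth] by fastforce
    qed
    then show "avoids {k} h r"
      by (simp add: avoids_def)
  next
    assume "avoids {k} h r"
    then show "\<forall>v\<in>{1..m}. tree_depth par r v < k"
      using depth_less_if_avoids piter_tree_depth by blast
  qed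
  finally show ?thesis .
qed

end

text \<open>The inverse reads a missing value as a fixed point, which restores both the loop at the
  root and the identity outside \<open>{1..m}\<close>.\<close>

lemma tree_map_bij:
  "bij_betw (tree_map m) {(par, r). rooted_tree m par r} (SIGMA r:{1..m}. ptree {1..m} r)"
proof (rule bij_betw_byWitness[where f' = "\<lambda>(r, h). (\<lambda>v. case h v of None \<Rightarrow> v | Some w \<Rightarrow> w, r)"])
  let ?inv = "\<lambda>(r, h). (\<lambda>v. case h v of None \<Rightarrow> v | Some w \<Rightarrow> (w :: nat), r :: nat)"
  show "\<forall>p\<in>{(par, r). rooted_tree m par r}. ?inv (tree_map m p) = p"
    by (auto simp: tree_map_def rooted_tree_def fun_eq_iff)
  show "\<forall>q\<in>SIGMA r:{1..m}. ptree {1..m} r. tree_map m (?inv q) = q"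
  proof
    fix q assume "q \<in> (SIGMA r:{1..m}. ptree {1..m} r)"
    then obtain r h where q: "q = (r, h)" "h \<in> ptree {1..m} r"
      by auto
    then have "dom h = {1..m} - {r}"
      by (simp add: ptree_def)
    then have None: "h v = None \<longleftrightarrow> v \<notin> {1..m} \<or> v = r" for v
      by (metis Diff_iff domIff singleton_iff)
    then have "(if v \<in> {1..m} \<and> v \<noteq> r then Some (case h v of None \<Rightarrow> v | Some w \<Rightarrow> w) else None) = h v" for v
    proof (cases "v \<in> {1..m} \<and> v \<noteq> r")
      case True
      with None[of v] obtain w where "h v = Some w"
        by auto
      with True show ?thesis
        by simp
    next
      case False
      with None[of v] have "h v = None"
        by blast
      with False show ?thesis
        by simp
    qed
    then show "tree_map m (?inv q) = q"
      by (simp add: q(1) tree_map_def)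
  qed
  show "tree_map m ` {(par, r). rooted_tree m par r} \<subseteq> (SIGMA r:{1..m}. ptree {1..m} r)"
    using tree_map_ptree by (fastforce simp: tree_map_def rooted_tree_def)
  show "?inv ` (SIGMA r:{1..m}. ptree {1..m} r) \<subseteq> {(par, r). rooted_tree m par r}"
  proof
    fix p assume "p \<in> ?inv ` (SIGMA r:{1..m}. ptree {1..m} r)"
    then obtain r h where p: "p = ?inv (r, h)" and r: "r \<in> {1..m}" and h: "h \<in> ptree {1..m} r"
      by auto
    define par where "par = (\<lambda>v. case h v of None \<Rightarrow> v | Some w \<Rightarrow> w)"
    have par: "h v = Some w \<Longrightarrow> par v = w" for v w
      by (simp add: par_def)
    have None: "h v = None" if "v \<notin> {1..m} - {r}" for v
      using that ptree_domD[OF h] by (metis option.exhaust)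
    have "par v \<in> {1..m}" if "v \<in> {1..m}" for v
      using that ptree_ranD[OF h, of v] by (auto simp: par_def split: option.split)
    moreover have "\<exists>j. (par ^^ j) v = r" if "v \<in> {1..m}" for v
    proof -
      have "v \<in> basin h r"
        using h that by (auto simp: ptree_def)
      then obtain j where "piter h j v = Some r"
        by (auto simp: basin_def)
      then show ?thesis
        using piter_imp_funpow[of h par, OF par] by blast
    qed
    moreover have "par v = v" if "v \<notin> {1..m} - {r}" for v
      using None[OF that] by (simp add: par_def)
    ultimately have "rooted_tree m par r"
      using r unfolding rooted_tree_def by auto
    then show "p \<in> {(par, r). rooted_tree m par r}"
      by (simp add: p par_def)
  qed
qed

lemma card_tree_map:
  assumes "\<And>par r. rooted_tree m par r \<Longrightarrow> Q par r \<longleftrightarrow> R (tree_map m (par, r))"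
  shows "card {(par, r). rooted_tree m par r \<and> Q par r} =
    card {q \<in> SIGMA r:{1..m}. ptree {1..m} r. R q}"
proof -
  have "{(par, r). rooted_tree m par r \<and> Q par r} =
      {p \<in> {(par, r). rooted_tree m par r}. case p of (par, r) \<Rightarrow> Q par r}"
    by auto
  then show ?thesis
    using bij_betw_same_card[OF bij_betw_Collect[where Q = R and P = "\<lambda>(par, r). Q par r", OF tree_map_bij]] assms
    by auto
qed

lemma n_trees_le_eq: "n_trees_le P (int k - 1) m = card (ptrees P {k} {1..m})"
proof -
  have "n_trees_le P (int k - 1) m = card {q \<in> SIGMA r:{1..m}. ptree {1..m} r.
      (\<forall>v\<in>{1..m}. card {y. snd q y = Some v} \<in> P) \<and> avoids {k} (snd q) (fst q)}"
    unfolding n_trees_le_def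
    by (rule card_tree_map) (simp only: tree_map_def prod.case fst_conv snd_conv tree_height_less_iff[OF _ refl] sat_P_iff[OF _ refl])
  also have "{q \<in> SIGMA r:{1..m}. ptree {1..m} r.
      (\<forall>v\<in>{1..m}. card {y. snd q y = Some v} \<in> P) \<and> avoids {k} (snd q) (fst q)} = ptrees P {k} {1..m}"
    by (auto simp: ptrees_def)
  finally show ?thesis .
qed

lemma n_trees_eq: "n_trees P m = card (ptrees P {} {1..m})"
proof -
  have "n_trees P m = card {q \<in> SIGMA r:{1..m}. ptree {1..m} r.
      \<forall>v\<in>{1..m}. card {y. snd q y = Some v} \<in> P}"
    unfolding n_trees_def
    by (rule card_tree_map) (simp only: tree_map_def prod.case fst_conv snd_conv sat_P_iff[OF _ refl])
  also have "{q \<in> SIGMA r:{1..m}. ptree {1..m} r.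
      \<forall>v\<in>{1..m}. card {y. snd q y = Some v} \<in> P} = ptrees P {} {1..m}"
    by (auto simp: ptrees_def avoids_def)
  finally show ?thesis .
qed

text \<open>A finite tree has a leaf: if every vertex had a preimage, \<open>h\<close> would map
  \<open>B - {x}\<close> onto \<open>B\<close>.\<close>

lemma ptrees_empty:
  assumes "0 \<notin> P" "finite B"
  shows "ptrees P K B = {}"
proof (rule equals0I)
  fix q assume "q \<in> ptrees P K B"
  then obtain x h where x: "x \<in> B" and h: "h \<in> ptree B x" and P: "\<forall>v\<in>B. card {y. h y = Some v} \<in> P"
    by (auto simp: ptrees_def)
  have "B \<subseteq> (the \<circ> h) ` (B - {x})"
  proof
    fix v assume "v \<in> B"
    then have "{y. h y = Some v} \<noteq> {}"
      using P assms(1) by force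
    then obtain y where "h y = Some v"
      by blast
    then show "v \<in> (the \<circ> h) ` (B - {x})"
      using ptree_domD[OF h] by force
  qed
  then have "card B \<le> card (B - {x})"
    using assms(2) by (meson card_image_le card_mono finite_Diff finite_imageI order_trans)
  then show False
    using x assms(2) by (metis card_Diff1_less leD)
qed

section \<open>Counting maps with a marked point\<close>

lemma double_count:
  assumes "finite V" "finite A"
  shows "(\<Sum>x\<in>V. card {f \<in> A. R x f}) = (\<Sum>f\<in>A. card {x \<in> V. R x f})"
  using sum.swap_restrict[OF assms, of "\<lambda>_ _. 1" R] by (simp only: card_eq_sum)

lemma avoids_imp_aperiodic:
  assumes "avoids {k} f x"
  shows "aperiodic f x"
  unfolding aperiodic_def
proof (intro allI impI notI)
  fix p :: nat
  assume p: "p > 0" "piter f p x = Some x"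
  \<comment> \<open>The multiple \<open>k * p\<close> of the period is at least \<open>k\<close>;
    the point reached after \<open>k * p - k\<close> steps is sent to \<open>x\<close> by the
    iterate \<open>k\<close>.\<close>
  have "piter f (n * p) x = Some x" for n
    by (induction n) (simp_all add: piter_add p(2))
  then have "Option.bind (piter f (k * p - k) x) (piter f k) = Some x"
    using piter_add[of f "k * p - k" k x] p(1) by simp
  then show False
    using assms by (auto simp: avoids_def Option.bind_eq_Some_conv)
qed

text \<open>Swapping the sums over \<open>x\<close> and \<open>B\<close> collects all choices of a
  root in \<open>B\<close>, that is, all trees on \<open>B\<close>. For this the weight
  \<open>r\<close> of the rest must not depend on the root.\<close>

lemma sum_ptrees_convolution:
  fixes r :: "nat set \<Rightarrow> 'a::comm_ring_1"
  assumes ring: "rat_ring TYPE('a)" and V: "finite V"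
    and a: "\<And>x. x \<in> V \<Longrightarrow> a x = (\<Sum>B\<in>{B\<in>Pow V. x \<in> B}.
      of_nat (card {h \<in> ptree B x. (\<forall>v\<in>B. card {y. h y = Some v} \<in> P) \<and> avoids K h x}) * r (V - B))"
    and r: "\<And>W. W \<subseteq> V \<Longrightarrow> r W * qinv (fact (card W)) = G $ card W"
  shows "(\<Sum>x\<in>V. a x) * qinv (fact (card V)) = (egf (\<lambda>m. card (ptrees P K {1..m})) * G) $ card V"
proof -
  let ?H = "\<lambda>B x. {h \<in> ptree B x. (\<forall>v\<in>B. card {y. h y = Some v} \<in> P) \<and> avoids K h x}"
  have fin: "finite B" if "B \<in> Pow V" for B
    using that V finite_subset by auto
  have "(\<Sum>x\<in>V. a x) = (\<Sum>x\<in>V. \<Sum>B\<in>{B\<in>Pow V. x \<in> B}. of_nat (card (?H B x)) * r (V - B))"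
    using a by (rule sum.cong[OF refl])
  also have "\<dots> = (\<Sum>B\<in>Pow V. \<Sum>x\<in>{x\<in>V. x \<in> B}. of_nat (card (?H B x)) * r (V - B))"
    using V by (intro sum.swap_restrict) auto
  also have "\<dots> = (\<Sum>B\<in>Pow V. of_nat (card (ptrees P K B)) * r (V - B))"
  proof (rule sum.cong[OF refl])
    fix B assume B: "B \<in> Pow V"
    then have "{x\<in>V. x \<in> B} = B"
      by auto
    moreover have "card (ptrees P K B) = (\<Sum>x\<in>B. card (?H B x))"
      unfolding ptrees_def using fin[OF B] by (intro card_SigmaI) (auto simp: finite_ptree)
    ultimately show "(\<Sum>x\<in>{x\<in>V. x \<in> B}. of_nat (card (?H B x)) * r (V - B)) =
        of_nat (card (ptrees P K B)) * r (V - B)"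
      by (simp add: sum_distrib_right)
  qed
  also have "\<dots> * qinv (fact (card V)) = (egf (\<lambda>m. card (ptrees P K {1..m})) * G) $ card V"
  proof (rule subset_convolution[OF ring V])
    fix B assume "B \<subseteq> V"
    then have "card (ptrees P K B) = card (ptrees P K {1..card B})"
      using fin by (intro card_ptrees_cong) auto
    then show "of_nat (card (ptrees P K B)) * qinv (fact (card B)) =
        (egf (\<lambda>m. card (ptrees P K {1..m})) :: 'a fps) $ card B"
      by (simp add: egf_def)
  qed (rule r)
  finally show ?thesis .
qed

lemma sum_card_avoids:
  assumes ring: "rat_ring TYPE('a::comm_ring_1)" and V: "finite V"
  shows "of_nat (\<Sum>x\<in>V. card {f \<in> fmaps E P V V. avoids {k} f x}) * qinv (fact (card V)) =
    (egf (\<lambda>m. card (ptrees P {k} {1..m})) *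
      Abs_fps (\<lambda>n. fps_deriv (eP E * eP P ^ n) $ n) :: 'a fps) $ card V"
proof -
  \<comment> \<open>This is the number of maps from \<open>insert x W\<close> to \<open>W\<close>.
    The source has one point more than the target, so \<open>card_fmaps\<close> gives coefficient
    \<open>card W + 1\<close>; the extra factor of the factorial turns it into a coefficient of the
    derivative.\<close>
  define r where "r W = of_nat (fact (card W)) * fps_deriv (eP E * eP P ^ card W :: 'a fps) $ card W"
    for W :: "nat set"
  have r: "of_nat (card (fmaps E P (insert x W) W)) = r W" if "finite W" "x \<notin> W" for x W
  proof -
    have "of_nat (card (fmaps E P (insert x W) W)) =
        of_nat (fact (Suc (card W))) * (eP E * eP P ^ card W :: 'a fps) $ Suc (card W)"
      using card_fmaps[OF ring, of "insert x W" W E P] that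
      by (intro eq_of_nat_mult_if_mult_qinv_eq[OF ring]) simp_all
    then show ?thesis
      by (simp only: r_def fps_deriv_nth fact_Suc of_nat_mult of_nat_id Suc_eq_plus1[symmetric] mult_ac)
  qed
  show ?thesis
    unfolding of_nat_sum
  proof (rule sum_ptrees_convolution[OF ring V])
    fix x assume x: "x \<in> V"
    let ?\<Phi> = "\<lambda>f. card (V - dom f) \<in> E \<and> (\<forall>v\<in>V. card {y. f y = Some v} \<in> P) \<and> avoids {k} f x"
    let ?\<Phi>1 = "\<lambda>B h. (\<forall>v\<in>B. card {y. h y = Some v} \<in> P) \<and> avoids {k} h x"
    let ?\<Phi>2 = "\<lambda>B g. card (insert x (V - B) - dom g) \<in> E \<and> (\<forall>v\<in>V-B. card {y. g y = Some v} \<in> P)"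
    have \<Phi>: "?\<Phi> (h ++ g) \<longleftrightarrow> ?\<Phi>1 B h \<and> ?\<Phi>2 B g"
      if "x \<in> B" "B \<subseteq> V" "h \<in> ptree B x" "g \<in> pmaps (insert x (V - B)) (V - B)" for B h g
    proof -
      have "avoids {k} (h ++ g) x \<longleftrightarrow> avoids {k} h x"
        by (simp only: avoids_def glue_piter_iff[OF that])
      then show ?thesis
        by (simp only: glue_undefined[OF that] glue_fibres[OF that]) blast
    qed
    have "{f \<in> fmaps E P V V. avoids {k} f x} = {f \<in> pmaps V V. aperiodic f x \<and> ?\<Phi> f}"
      using avoids_imp_aperiodic by (auto simp: fmaps_def)
    then have "card {f \<in> fmaps E P V V. avoids {k} f x} = (\<Sum>B\<in>{B\<in>Pow V. x \<in> B}.
        card {h \<in> ptree B x. ?\<Phi>1 B h} * card {g \<in> pmaps (insert x (V - B)) (V - B). ?\<Phi>2 B g})"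
      using card_aperiodic_decompose[OF V x, of ?\<Phi> ?\<Phi>1 ?\<Phi>2, OF \<Phi>] by simp
    also have "\<dots> = (\<Sum>B\<in>{B\<in>Pow V. x \<in> B}.
        card {h \<in> ptree B x. ?\<Phi>1 B h} * card (fmaps E P (insert x (V - B)) (V - B)))"
      by (simp only: fmaps_def)
    finally show "of_nat (card {f \<in> fmaps E P V V. avoids {k} f x}) = (\<Sum>B\<in>{B\<in>Pow V. x \<in> B}.
        of_nat (card {h \<in> ptree B x. ?\<Phi>1 B h}) * r (V - B))"
      using V by (simp add: r)
  next
    fix W assume "W \<subseteq> V"
    have "r W * qinv (fact (card W)) =
        (of_nat (fact (card W)) * qinv (fact (card W))) * fps_deriv (eP E * eP P ^ card W) $ card W"
      by (simp only: r_def mult_ac)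
    then show "r W * qinv (fact (card W)) = Abs_fps (\<lambda>n. fps_deriv (eP E * eP P ^ n) $ n) $ card W"
      using of_nat_mult_qinv[OF ring, of "fact (card W)"] by simp
  qed
qed

text \<open>A point without a value is aperiodic, and its basin may be a tree of any height, hence
  \<open>K = {}\<close>. What remains is a map from \<open>V - B\<close> to itself with one
  undefined point fewer, hence \<open>shiftP E 1\<close>.\<close>

lemma sum_card_undefined:
  assumes ring: "rat_ring TYPE('a::comm_ring_1)" and V: "finite V"
  shows "of_nat (\<Sum>x\<in>V. card {f \<in> fmaps E P V V. f x = None}) * qinv (fact (card V)) =
    (egf (\<lambda>m. card (ptrees P {} {1..m})) * diag (eP P) (eP (shiftP E 1)) :: 'a fps) $ card V"
proof -
  define r :: "nat set \<Rightarrow> 'a" where "r W = of_nat (card (fmaps (shiftP E 1) P W W))" for W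
  show ?thesis
    unfolding of_nat_sum
  proof (rule sum_ptrees_convolution[OF ring V])
    fix x assume x: "x \<in> V"
    let ?\<Phi> = "\<lambda>f. card (V - dom f) \<in> E \<and> (\<forall>v\<in>V. card {y. f y = Some v} \<in> P) \<and> f x = None"
    let ?\<Phi>1 = "\<lambda>B h. (\<forall>v\<in>B. card {y. h y = Some v} \<in> P) \<and> avoids {} h x"
    let ?\<Phi>2 = "\<lambda>B g. card (insert x (V - B) - dom g) \<in> E \<and> (\<forall>v\<in>V-B. card {y. g y = Some v} \<in> P) \<and> g x = None"
    have \<Phi>: "?\<Phi> (h ++ g) \<longleftrightarrow> ?\<Phi>1 B h \<and> ?\<Phi>2 B g"
      if "x \<in> B" "B \<subseteq> V" "h \<in> ptree B x" "g \<in> pmaps (insert x (V - B)) (V - B)" for B h g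
    proof -
      have "(h ++ g) x = g x"
        by (rule glue_out[OF that]) simp
      moreover have "avoids {} h x"
        by (simp add: avoids_def)
      ultimately show ?thesis
        by (simp only: glue_undefined[OF that] glue_fibres[OF that]) blast
    qed
    have "{f \<in> fmaps E P V V. f x = None} = {f \<in> pmaps V V. aperiodic f x \<and> ?\<Phi> f}"
      using aperiodic_if_None by (auto simp: fmaps_def)
    then have "card {f \<in> fmaps E P V V. f x = None} = (\<Sum>B\<in>{B\<in>Pow V. x \<in> B}.
        card {h \<in> ptree B x. ?\<Phi>1 B h} * card {g \<in> pmaps (insert x (V - B)) (V - B). ?\<Phi>2 B g})"
      using card_aperiodic_decompose[OF V x, of ?\<Phi> ?\<Phi>1 ?\<Phi>2, OF \<Phi>] by simp
    also have "\<dots> = (\<Sum>B\<in>{B\<in>Pow V. x \<in> B}.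
        card {h \<in> ptree B x. ?\<Phi>1 B h} * card (fmaps (shiftP E 1) P (V - B) (V - B)))"
    proof (rule sum.cong[OF refl])
      fix B assume "B \<in> {B\<in>Pow V. x \<in> B}"
      then have B: "x \<notin> V - B"
        by auto
      have "card (insert x (V - B) - dom g) = Suc (card (V - B - dom g))" if "g x = None" for g :: "nat \<Rightarrow> nat option"
      proof -
        have "insert x (V - B) - dom g = insert x (V - B - dom g)"
          using that by auto
        then show ?thesis
          using B V by simp
      qed
      moreover have "g \<in> pmaps (insert x (V - B)) (V - B) \<and> g x = None \<longleftrightarrow> g \<in> pmaps (V - B) (V - B)" for g
        using B by (auto simp: pmaps_def)
      ultimately have "g \<in> pmaps (insert x (V - B)) (V - B) \<and> ?\<Phi>2 B g \<longleftrightarrow>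
          g \<in> fmaps (shiftP E 1) P (V - B) (V - B)" for g
        unfolding fmaps_def mem_shiftP_iff mem_Collect_eq by (metis Suc_eq_plus1)
      then have "{g \<in> pmaps (insert x (V - B)) (V - B). ?\<Phi>2 B g} = fmaps (shiftP E 1) P (V - B) (V - B)"
        by blast
      then show "card {h \<in> ptree B x. ?\<Phi>1 B h} * card {g \<in> pmaps (insert x (V - B)) (V - B). ?\<Phi>2 B g} =
          card {h \<in> ptree B x. ?\<Phi>1 B h} * card (fmaps (shiftP E 1) P (V - B) (V - B))"
        by (simp only:)
    qed
    finally show "of_nat (card {f \<in> fmaps E P V V. f x = None}) = (\<Sum>B\<in>{B\<in>Pow V. x \<in> B}.
        of_nat (card {h \<in> ptree B x. ?\<Phi>1 B h}) * r (V - B))"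
      by (simp add: r_def)
  next
    fix W assume "W \<subseteq> V"
    then have "finite W"
      using V finite_subset by auto
    then show "r W * qinv (fact (card W)) = diag (eP P) (eP (shiftP E 1)) $ card W"
      using card_fmaps[OF ring] by (simp add: r_def diag_def)
  qed
qed

lemma eP_singleton: "eP {s} = fps_const (qinv (fact s)) * fps_X ^ s"
  by (rule fps_ext) (simp add: eP_def fps_X_power_nth)

lemma diag_const_mult: "diag \<phi> (fps_const c * H) = fps_const c * diag \<phi> H"
  by (rule fps_ext) (simp add: diag_def mult.assoc)

text \<open>Mark a point without a value in a partial map having \<open>Suc s\<close> of them: its basin is an
  arbitrary tree, the rest a partial map with \<open>s\<close> such points.\<close>
lemma diag_X_power:
  assumes ring: "rat_ring TYPE('a::comm_ring_1)"
  shows "diag (eP P) (fps_X ^ s) = T_all P ^ s * (diag (eP P) 1 :: 'a fps)"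
proof (induction s)
  case (Suc s)
  let ?T = "T_all P :: 'a fps"
  have T: "?T = egf (\<lambda>m. card (ptrees P {} {1..m}))"
    by (simp only: T_all_def n_trees_eq[abs_def])
  have shift: "shiftP {Suc s} 1 = {s}"
    by (auto simp: shiftP_def)
  \<comment> \<open>\<open>eP {j}\<close> is \<open>fps_X ^ j\<close> divided by
    \<open>j!\<close>.\<close>
  have const: "fps_const (of_nat (fact j)) * diag (eP P) (eP {j}) = (diag (eP P) (fps_X ^ j) :: 'a fps)" for j
    using of_nat_mult_qinv[OF ring, of "fact j"]
    by (simp add: eP_singleton diag_const_mult flip: mult.assoc)
  \<comment> \<open>Both sides count maps with a marked undefined point among \<open>s + 1\<close>:
    the left by choosing the mark, the right by cutting at it.\<close>
  have "fps_const (of_nat (Suc s)) * diag (eP P) (eP {Suc s}) = ?T * diag (eP P) (eP {s})"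
  proof (rule fps_ext)
    fix n
    let ?V = "{1..n} :: nat set"
    have "(\<Sum>x\<in>?V. card {f \<in> fmaps {Suc s} P ?V ?V. f x = None}) =
        (\<Sum>f\<in>fmaps {Suc s} P ?V ?V. card {x\<in>?V. f x = None})"
      by (rule double_count) (simp_all add: finite_fmaps)
    also have "\<dots> = (\<Sum>f\<in>fmaps {Suc s} P ?V ?V. Suc s)"
    proof (rule sum.cong[OF refl])
      fix f assume "f \<in> fmaps {Suc s} P ?V ?V"
      moreover have "{x\<in>?V. f x = None} = ?V - dom f"
        by auto
      ultimately show "card {x\<in>?V. f x = None} = Suc s"
        by (simp only: fmaps_def) simp
    qed
    also have "\<dots> = Suc s * card (fmaps {Suc s} P ?V ?V)"
      by simp
    finally have "of_nat (Suc s) * (of_nat (card (fmaps {Suc s} P ?V ?V)) * qinv (fact n)) =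
        (?T * diag (eP P) (eP {s})) $ n"
      using sum_card_undefined[OF ring, of ?V "{Suc s}" P]
      by (simp only: shift T of_nat_mult mult.assoc card_atLeastAtMost finite_atLeastAtMost diff_Suc_1)
    then show "(fps_const (of_nat (Suc s)) * diag (eP P) (eP {Suc s})) $ n = (?T * diag (eP P) (eP {s})) $ n"
      using card_fmaps[OF ring, of ?V ?V "{Suc s}" P] by (simp add: diag_def)
  qed
  then have "fps_const (of_nat (fact s)) * (fps_const (of_nat (Suc s)) * diag (eP P) (eP {Suc s})) =
      ?T * (fps_const (of_nat (fact s)) * diag (eP P) (eP {s}))"
    by (simp only: mult.left_commute)
  moreover have "fps_const (of_nat (fact s)) * fps_const (of_nat (Suc s)) =
      fps_const (of_nat (fact (Suc s)) :: 'a)"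
    by (simp add: algebra_simps)
  ultimately have "fps_const (of_nat (fact (Suc s))) * diag (eP P) (eP {Suc s}) =
      ?T * (fps_const (of_nat (fact s)) * diag (eP P) (eP {s}))"
    by (simp only: mult.assoc[symmetric])
  then have "diag (eP P) (fps_X ^ Suc s) = ?T * diag (eP P) (fps_X ^ s)"
    by (simp only: const)
  then show ?case
    using Suc.IH by (simp add: mult.assoc)
qed simp

section \<open>The derivative at u = 1 and unreached points\<close>

lemma dpoly_at1_eq:
  assumes "degree p \<le> N"
  shows "dpoly_at1 p = (\<Sum>i\<le>N. of_nat i * coeff p i)"
  unfolding dpoly_at1_def by (rule sum.mono_neutral_left) (use assms in \<open>auto simp: coeff_eq_0\<close>)

lemma dpoly_at1_add: "dpoly_at1 (p + q) = dpoly_at1 p + dpoly_at1 q"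
proof -
  let ?N = "max (degree p) (degree q)"
  have "dpoly_at1 (p + q) = (\<Sum>i\<le>?N. of_nat i * coeff (p + q) i)"
    by (rule dpoly_at1_eq) (rule degree_add_le_max)
  also have "\<dots> = (\<Sum>i\<le>?N. of_nat i * coeff p i) + (\<Sum>i\<le>?N. of_nat i * coeff q i)"
    by (simp add: distrib_left sum.distrib)
  also have "\<dots> = dpoly_at1 p + dpoly_at1 q"
    by (simp add: dpoly_at1_eq[of p ?N] dpoly_at1_eq[of q ?N])
  finally show ?thesis .
qed

lemma dpoly_at1_monom: "dpoly_at1 (monom c n) = of_nat n * c"
proof -
  have "dpoly_at1 (monom c n) = (\<Sum>i\<le>n. of_nat i * coeff (monom c n) i)"
    by (rule dpoly_at1_eq) (rule degree_monom_le)
  also have "\<dots> = of_nat n * c"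
    by (simp add: if_distrib[of "\<lambda>z. _ * z"] cong: if_cong)
  finally show ?thesis .
qed

lemma dpoly_at1_sum_monom: "dpoly_at1 (\<Sum>f\<in>A. monom c (e f)) = of_nat (\<Sum>f\<in>A. e f) * c"
proof -
  have "dpoly_at1 0 = 0"
    by (simp add: dpoly_at1_def)
  then show ?thesis
    by (induction A rule: infinite_finite_induct)
       (simp_all add: dpoly_at1_add dpoly_at1_monom distrib_right)
qed

lemma card_avoids:
  assumes "f \<in> pmaps {1..n} {1..n}"
  shows "n - card {y. \<exists>x\<in>{1..n}. piter f k x = Some y} = card {x\<in>{1..n}. avoids {k} f x}"
proof -
  \<comment> \<open>\<open>avoids\<close> ranges over all natural numbers, the image only over
    \<open>{1..n}\<close>. They agree because a positive iterate stays inside \<open>{1..n}\<close>,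
    while iterate 0 fixes every outside point.\<close>
  have image: "x \<in> {1..n} \<and> y \<in> {1..n} \<or> x = y \<and> x \<notin> {1..n}" if kxy: "piter f k x = Some y" for x y
  proof (cases k)
    case (Suc i)
    then obtain z where "f x = Some z"
      using kxy piter_Suc_left_eq_SomeE by metis
    moreover obtain w where "f w = Some y"
      using kxy Suc piter_Suc_eq_SomeE by metis
    ultimately have "x \<in> {1..n}" "y \<in> {1..n}"
      using assms by (auto simp: pmaps_def ran_def)
    then show ?thesis
      by blast
  qed (use kxy in auto)
  let ?I = "{y. \<exists>x\<in>{1..n}. piter f k x = Some y}"
  have "?I \<subseteq> {1..n}"
    using image by blast
  moreover have "{x\<in>{1..n}. avoids {k} f x} = {1..n} - ?I"
    unfolding avoids_def using image by blast
  ultimately show ?thesis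
    by (simp add: card_Diff_subset finite_subset)
qed

text \<open>The exponents of u count unreached points; summing over points before maps leads to
  \<open>sum_card_avoids\<close>.\<close>

lemma sum_unreached:
  assumes ring: "rat_ring TYPE('a::comm_ring_1)"
  shows "of_nat (\<Sum>f\<in>fmaps E P {1..n} {1..n}. n - card {y. \<exists>x\<in>{1..n}. piter f k x = Some y}) * qinv (fact n) =
    (T_le P (int k - 1) * Abs_fps (\<lambda>n. fps_deriv (eP E * eP P ^ n) $ n) :: 'a fps) $ n"
proof -
  have "(\<Sum>f\<in>fmaps E P {1..n} {1..n}. n - card {y. \<exists>x\<in>{1..n}. piter f k x = Some y}) =
      (\<Sum>f\<in>fmaps E P {1..n} {1..n}. card {x\<in>{1..n}. avoids {k} f x})"
    by (rule sum.cong[OF refl], rule card_avoids) (simp add: fmaps_def)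
  also have "\<dots> = (\<Sum>x\<in>{1..n}. card {f\<in>fmaps E P {1..n} {1..n}. avoids {k} f x})"
    by (rule double_count[symmetric]) (simp_all add: finite_fmaps)
  finally show ?thesis
    using sum_card_avoids[OF ring, of "{1..n}" E P k]
    by (simp only: T_le_def n_trees_le_eq[abs_def] card_atLeastAtMost finite_atLeastAtMost diff_Suc_1)
qed

section \<open>Partial and total functions as the cases \<open>E = UNIV\<close> and
  \<open>E = {0}\<close>\<close>

lemma Qfun_eq: "Qfun P n = fmaps UNIV P {1..n} {1..n}"
proof (rule set_eqI)
  fix f :: "nat \<Rightarrow> nat option"
  have "{y \<in> {1..n}. f y = Some x} = {y. f y = Some x}" if "dom f \<subseteq> {1..n}" for x
    using that by auto
  then show "f \<in> Qfun P n \<longleftrightarrow> f \<in> fmaps UNIV P {1..n} {1..n}"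
    by (cases "dom f \<subseteq> {1..n}") (simp_all add: Qfun_def fmaps_def pmaps_def)
qed

definition pmap_of :: "nat \<Rightarrow> (nat \<Rightarrow> nat) \<Rightarrow> nat \<Rightarrow> nat option" where
  "pmap_of n f x = (if x \<in> {1..n} then Some (f x) else None)"

lemma pmap_of_bij: "bij_betw (pmap_of n) (Ffun P n) (fmaps {0} P {1..n} {1..n})"
proof (rule bij_betw_byWitness[where f' = "\<lambda>g. restrict (\<lambda>x. the (g x)) {1..n}"])
  show "\<forall>f\<in>Ffun P n. restrict (\<lambda>x. the (pmap_of n f x)) {1..n} = f"
  proof
    fix f assume "f \<in> Ffun P n"
    then have "f \<in> extensional {1..n}"
      by (auto simp: Ffun_def PiE_def)
    then show "restrict (\<lambda>x. the (pmap_of n f x)) {1..n} = f"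
      by (intro extensionalityI[of _ "{1..n}"]) (simp_all add: pmap_of_def)
  qed
  have dom: "dom g = {1..n}" if "g \<in> fmaps {0} P {1..n} {1..n}" for g
    using that by (auto simp: fmaps_def pmaps_def)
  show "\<forall>g\<in>fmaps {0} P {1..n} {1..n}. pmap_of n (restrict (\<lambda>x. the (g x)) {1..n}) = g"
  proof
    fix g assume g: "g \<in> fmaps {0} P {1..n} {1..n}"
    show "pmap_of n (restrict (\<lambda>x. the (g x)) {1..n}) = g"
    proof
      fix x
      show "pmap_of n (restrict (\<lambda>x. the (g x)) {1..n}) x = g x"
      proof (cases "x \<in> {1..n}")
        case True
        then obtain w where "g x = Some w"
          using dom[OF g] by blast
        with True show ?thesis
          by (simp add: pmap_of_def)
      next
        case False
        then have "g x = None"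
          using dom[OF g] by blast
        with False show ?thesis
          by (simp add: pmap_of_def)
      qed
    qed
  qed
  show "pmap_of n ` Ffun P n \<subseteq> fmaps {0} P {1..n} {1..n}"
  proof
    fix g assume "g \<in> pmap_of n ` Ffun P n"
    then obtain f where f: "f \<in> Ffun P n" "g = pmap_of n f"
      by blast
    have "dom g = {1..n}"
      by (auto simp: f pmap_of_def dom_def)
    moreover have "ran g \<subseteq> {1..n}"
      using f by (auto simp: Ffun_def pmap_of_def ran_def)
    moreover have "{y. g y = Some v} = {y\<in>{1..n}. f y = v}" for v
      by (auto simp: f pmap_of_def)
    ultimately show "g \<in> fmaps {0} P {1..n} {1..n}"
      using f(1) by (simp add: Ffun_def fmaps_def pmaps_def)
  qed
  show "(\<lambda>g. restrict (\<lambda>x. the (g x)) {1..n}) ` fmaps {0} P {1..n} {1..n} \<subseteq> Ffun P n"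
  proof
    fix f assume "f \<in> (\<lambda>g. restrict (\<lambda>x. the (g x)) {1..n}) ` fmaps {0} P {1..n} {1..n}"
    then obtain g where g: "g \<in> fmaps {0} P {1..n} {1..n}" "f = restrict (\<lambda>x. the (g x)) {1..n}"
      by blast
    have "{y\<in>{1..n}. f y = v} = {y. g y = Some v}" for v
      using dom[OF g(1)] by (auto simp: g(2)) (metis domI domD atLeastAtMost_iff One_nat_def option.sel)+
    moreover have "f x \<in> {1..n}" if x: "x \<in> {1..n}" for x
    proof -
      obtain w where "g x = Some w"
        using dom[OF g(1)] x by blast
      then show ?thesis
        using g x by (auto simp: fmaps_def pmaps_def ran_def)
    qed
    ultimately show "f \<in> Ffun P n"
      using g by (auto simp: Ffun_def fmaps_def)
  qed
qed

lemma piter_pmap_of: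
  assumes "f \<in> Ffun P n" "x \<in> {1..n}"
  shows "piter (pmap_of n f) k x = Some ((f ^^ k) x)"
proof -
  have "(f ^^ k) x \<in> {1..n}" for k
    using assms by (induction k) (auto simp: Ffun_def)
  then show ?thesis
    by (induction k) (simp_all add: pmap_of_def)
qed

lemma F_egf_eq:
  assumes ring: "rat_ring TYPE('a::comm_ring_1)"
  shows "F_egf P = (diag (eP P) 1 :: 'a fps)"
proof (rule fps_ext)
  fix n
  have "eP {0} = (1 :: 'a fps)"
    using of_nat_mult_qinv[OF ring, of 1] by (simp add: eP_singleton)
  then show "F_egf P $ n = (diag (eP P) 1 :: 'a fps) $ n"
    using card_fmaps[OF ring, of "{1..n}" "{1..n}" "{0}" P] bij_betw_same_card[OF pmap_of_bij, of P n]
    by (simp add: F_egf_def egf_def diag_def)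
qed

lemma Xi_eq:
  assumes ring: "rat_ring TYPE('a::comm_ring_1)"
  shows "Xi k P = (T_le P (int k - 1) * Abs_fps (\<lambda>n. fps_deriv (eP {0} * eP P ^ n) $ n) :: 'a fps)"
proof (rule fps_ext)
  fix n
  have "(\<Sum>f\<in>fmaps {0} P {1..n} {1..n}. n - card {y. \<exists>x\<in>{1..n}. piter f k x = Some y}) =
      (\<Sum>f\<in>Ffun P n. n - card ((f ^^ k) ` {1..n}))"
  proof (subst sum.reindex_bij_betw[OF pmap_of_bij, symmetric], rule sum.cong[OF refl])
    fix f assume f: "f \<in> Ffun P n"
    then have "{y. \<exists>x\<in>{1..n}. piter (pmap_of n f) k x = Some y} = (f ^^ k) ` {1..n}"
      using piter_pmap_of[OF f] by force
    then show "n - card {y. \<exists>x\<in>{1..n}. piter (pmap_of n f) k x = Some y} = n - card ((f ^^ k) ` {1..n})"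
      by simp
  qed
  then show "Xi k P $ n = (T_le P (int k - 1) * Abs_fps (\<lambda>n. fps_deriv (eP {0} * eP P ^ n) $ n) :: 'a fps) $ n"
    unfolding sum_unreached[OF ring, symmetric] Xi_def du_at1_def Fk_def
    by (simp only: fps_nth_Abs_fps dpoly_at1_sum_monom)
qed

lemma Xi_partial_eq:
  assumes ring: "rat_ring TYPE('a::comm_ring_1)"
  shows "Xi_partial k P = (T_le P (int k - 1) * Abs_fps (\<lambda>n. fps_deriv (eP UNIV * eP P ^ n) $ n) :: 'a fps)"
  by (rule fps_ext)
     (simp only: sum_unreached[OF ring, symmetric] Xi_partial_def du_at1_def Pk_def Qfun_eq
       fps_nth_Abs_fps dpoly_at1_sum_monom)

lemma T_le_eq_0:
  assumes "0 \<notin> P"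
  shows "T_le P (int k - 1) = 0"
  by (rule fps_ext) (simp add: T_le_def egf_def n_trees_le_eq ptrees_empty[OF assms])

theorem theorem5p15:
  fixes k :: nat and P :: "nat set"
  assumes "rat_ring TYPE('a::comm_ring_1)"
  shows "(Xi k P :: 'a fps) =
           fps_X * T_le P (int k - 1) * (eP (shiftP P 2) oo T_all P) * F_egf P ^ 3 \<and>
         (Xi_partial k P :: 'a fps) =
           T_le P (int k - 1) * F_egf P ^ 2 * (eP UNIV oo T_all P) *
           (fps_X * (eP (shiftP P 2) oo T_all P) * F_egf P + 1)"
proof (cases "0 \<in> P")
  \<comment> \<open>Trees need leaves, so both sides carry the factor
    \<open>T_le P (int k - 1) = 0\<close>.\<close>
  case False
  then show ?thesis
    by (simp add: Xi_eq[OF assms] Xi_partial_eq[OF assms] T_le_eq_0)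
next
  case True
  have one: "qinv (Suc 0) = (1 :: 'a)" and eP0: "eP {0} = (1 :: 'a fps)"
    using of_nat_mult_qinv[OF assms, of 1] by (simp_all add: eP_singleton)
  have T0: "T_all P $ 0 = (0 :: 'a)"
    by (simp add: T_all_def egf_def n_trees_eq ptrees_def)
  have \<phi>0: "eP P $ 0 = (1 :: 'a)"
    using True one by (simp add: eP_def)
  have \<phi>'': "fps_deriv (fps_deriv (eP P)) = (eP (shiftP P 2) :: 'a fps)"
    by (simp add: fps_deriv_eP[OF assms] shiftP_shiftP numeral_2_eq_2)
  have "shiftP UNIV 1 = UNIV"
    by (auto simp: mem_shiftP_iff)
  then have exp': "fps_deriv (eP UNIV) = (eP UNIV :: 'a fps)"
    by (simp add: fps_deriv_eP[OF assms])
  \<comment> \<open>For total functions \<open>H = 1\<close>, and \<open>H' = 0\<close> removes the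
    second summand; for partial ones \<open>H = H' = eP UNIV\<close> contributes to both.\<close>
  note main = diag_deriv[OF assms T0 \<phi>0 diag_X_power[OF assms], unfolded \<phi>'']
  show ?thesis
    unfolding Xi_eq[OF assms] Xi_partial_eq[OF assms] main F_egf_eq[OF assms] exp' eP0
    by (simp add: algebra_simps power2_eq_square power3_eq_cube)
qed

end
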